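(* Let $\zeta=(P,B,\Delta_P)$ be a quantum principal $\mathcal G$-bundle with a differential calculus, let $\mathfrak F\in\mathfrak{qGG}$ be a quantum gauge transformation with associated convolution invertible map $\mathfrak f_{\mathfrak F}:\Gamma^\wedge\to\Omega^\bullet(P)$, and let $\omega$ be a quantum principal connection with curvature $R^\omega$. Write $\mathfrak F^{\circledast}\omega=\mathfrak F\circ\omega$ and let $m_\Omega:\Omega^\bullet(P)\otimes\Omega^\bullet(P)\to\Omega^\bullet(P)$ be the product. Then $$\mathfrak F^{\circledast}\omega=m_{\Omega}\circ(\omega\otimes \mathfrak f_{\mathfrak F})\circ \mathrm{ad} +\mathfrak f_{\mathfrak F}|_{\mathfrak{qg}^\#},\qquad \mathfrak F\circ R^{\omega}=m_{\Omega}\circ(R^{\omega}\otimes \mathfrak f_{\mathfrak F})\circ \mathrm{ad}.$$ If in addition $\mathfrak F$ is a graded differential algebra morphism, then $\mathfrak F\circ R^{\omega}=R^{\mathfrak F^{\circledast}\omega}$.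
   Context: All algebras are associative unital $\ast$-algebras over $\mathbb C$. $\mathcal G$ is a compact matrix quantum group (Woronowicz) with dense $\ast$-Hopf algebra $(H,\Delta,\epsilon,S,\ast)$; Sweedler notation is used. A corepresentation is a linear map $\delta^V:V\to V\otimes H$ with $(\mathrm{id}\otimes\epsilon)\delta^V=\mathrm{id}$, $(\mathrm{id}\otimes\Delta)\delta^V=(\delta^V\otimes\mathrm{id})\delta^V$. A quantum principal $\mathcal G$-bundle (qpb) $\zeta=(P,B,\Delta_P)$: a $\ast$-algebra $P$, a $\ast$-subalgebra $B$, and a $\ast$-algebra morphism $\Delta_P:P\to P\otimes H$ that is a corepresentation, such that $\Delta_P(x)=x\otimes 1$ iff $x\in B$, and $x\otimes y\mapsto (x\otimes 1)\Delta_P(y)$ maps $P\otimes P$ onto $P\otimes H$. Standing assumption: $B$ can be completed to a $C^\ast$-algebra. Graded differential $\ast$-algebras have $d(w^\ast)=(dw)^\ast$, $(wv)^\ast=(-1)^{kl}v^\ast w^\ast$ for degrees $k,l$, and tensor products are graded. Let $(\Gamma,d)$ be a bicovariant first-order differential $\ast$-calculus over $H$, $\mathfrak{qg}^\#\subset\Gamma$ its space of left-invariant elements, $\pi:H\to\mathfrak{qg}^\#$, $\pi(g)=S(g^{(1)})dg^{(2)}$ (surjective), $\mathrm{ad}:\mathfrak{qg}^\#\to\mathfrak{qg}^\#\otimes H$ the corepresentation with $\mathrm{ad}(\pi(g))=\pi(g^{(2)})\otimes S(g^{(1)})g^{(3)}$. $\Gamma^\wedge$ is the universal differential envelope: the quotient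 of $\bigoplus_k\Gamma^{\otimes_H k}$ by the two-sided ideal generated by $\sum_i dg_i\otimes_H dh_i$ whenever $\sum_i g_i\,dh_i=0$; it is a graded differential $\ast$-Hopf algebra extending $H$, with $\Delta(\theta)=1\otimes\theta+\mathrm{ad}(\theta)$ for $\theta\in\mathfrak{qg}^\#$. A differential calculus on $\zeta$: such a $(\Gamma,d)$ together with a graded differential $\ast$-algebra $\Omega^\bullet(P)$ generated by $\Omega^0(P)=P$ such that $\Delta_P$ extends to a graded differential $\ast$-algebra morphism $\Delta_{\Omega^\bullet(P)}:\Omega^\bullet(P)\to\Omega^\bullet(P)\otimes\Gamma^\wedge$. $\mathrm{Hor}^\bullet P=\{\varphi:\Delta_{\Omega^\bullet(P)}(\varphi)\in\Omega^\bullet(P)\otimes H\}$ with corepresentation $\Delta_{\mathrm{Hor}}=\Delta_{\Omega^\bullet(P)}|_{\mathrm{Hor}^\bullet P}$. $\Omega^\bullet(B)=\{\mu\in\Omega^\bullet(P):\Delta_{\Omega^\bullet(P)}(\mu)=\mu\otimes1\}$. A quantum principal connection (qpc) is a linear map $\omega:\mathfrak{qg}^\#\to\Omega^1(P)$ with $\Delta_{\Omega^\bullet(P)}(\omega(\theta))=(\omega\otimes\mathrm{id}_H)\mathrm{ad}(\theta)+1\otimes\theta$. Curvature: fix an embedded differential, i.e. a linear map $\Theta:\mathfrak{qg}^\#\to\mathfrak{qg}^\#\otimes\mathfrak{qg}^\#$ intertwining $\mathrm{ad}$ and $\mathrm{ad}^{\otimes2}$ (tensor product corepresentation), such that if $\Theta(\theta)=\sum\theta_i\otimes\theta'_j$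 then $d\theta=\sum\theta_i\theta'_j$ in $\Gamma^\wedge$ and $\Theta(\theta^\ast)=-\sum\theta_j'^\ast\otimes\theta_i^\ast$. Then $R^\omega=d\circ\omega-\langle\omega,\omega\rangle:\mathfrak{qg}^\#\to\Omega^2(P)$ with $\langle\omega,\omega\rangle=m_\Omega\circ(\omega\otimes\omega)\circ\Theta$. It is known that $R^\omega$ takes values in $\mathrm{Hor}^2P$ and $(R^\omega\otimes\mathrm{id}_H)\circ\mathrm{ad}=\Delta_{\mathrm{Hor}}\circ R^\omega$. The quantum gauge group $\mathfrak{qGG}$ is the group of all graded left $\Omega^\bullet(B)$-module isomorphisms $\mathfrak F:\Omega^\bullet(P)\to\Omega^\bullet(P)$ with $\mathfrak F(1)=1$ and $(\mathfrak F\otimes\mathrm{id}_{\Gamma^\wedge})\circ\Delta_{\Omega^\bullet(P)}=\Delta_{\Omega^\bullet(P)}\circ\mathfrak F$. The map $\widetilde\beta:\Omega^\bullet(P)\otimes_{\Omega^\bullet(B)}\Omega^\bullet(P)\to\Omega^\bullet(P)\otimes\Gamma^\wedge$, $\widetilde\beta(w_1\otimes w_2)=(w_1\otimes1)\Delta_{\Omega^\bullet(P)}(w_2)$, is known to be bijective; the quantum translation map is $\mathrm{qtrs}(\vartheta)=\widetilde\beta^{-1}(1\otimes\vartheta)$, $\vartheta\in\Gamma^\wedge$. The map associated with $\mathfrak F$ is $\mathfrak f_{\mathfrak F}=m\circ(\mathrm{id}\otimes_{\Omega^\bullet(B)}\mathfrak F)\circ\mathrm{qtrs}$, where $m:\Omega^\bullet(P)\otimes_{\Omega^\bullet(B)}\Omega^\bullet(P)\to\Omega^\bullet(P)$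 is the product. *)

theory Defs
  imports Complex_Main "HOL-Library.Poly_Mapping"
begin

section \<open>Complex vector spaces and free vector spaces\<close>

class scaleC =
  fixes scaleC :: "complex \<Rightarrow> 'a \<Rightarrow> 'a" (infixr "*\<^sub>C" 75)

class complex_vector = scaleC + ab_group_add +
  assumes scaleC_add_right: "a *\<^sub>C (x + y) = a *\<^sub>C x + a *\<^sub>C y"
    and scaleC_add_left: "(a + b) *\<^sub>C x = a *\<^sub>C x + b *\<^sub>C x"
    and scaleC_scaleC: "a *\<^sub>C (b *\<^sub>C x) = (a * b) *\<^sub>C x"
    and scaleC_one: "1 *\<^sub>C x = x"

global_interpretation cvec: vector_space "scaleC :: complex \<Rightarrow> 'a \<Rightarrow> 'a::complex_vector"
  defines cspan = cvec.span
    and csubspace = cvec.subspace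
  by unfold_locales (simp_all add: scaleC_add_right scaleC_add_left scaleC_scaleC scaleC_one)

abbreviation clinear :: "('a::complex_vector \<Rightarrow> 'b::complex_vector) \<Rightarrow> bool"
  where "clinear \<equiv> Vector_Spaces.linear scaleC scaleC"

definition cbilinear :: "('a::complex_vector \<Rightarrow> 'b::complex_vector \<Rightarrow> 'c::complex_vector) \<Rightarrow> bool"
  where "cbilinear f \<longleftrightarrow> (\<forall>x. clinear (f x)) \<and> (\<forall>y. clinear (\<lambda>x. f x y))"

lemma clinear_iff:
  "clinear f \<longleftrightarrow> (\<forall>x y. f (x + y) = f x + f y) \<and> (\<forall>c x. f (c *\<^sub>C x) = c *\<^sub>C f x)"
  by (auto simp: Vector_Spaces.linear_iff cvec.vector_space_axioms)

lemma clinearI: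
  assumes "\<And>x y. f (x + y) = f x + f y" "\<And>c x. f (c *\<^sub>C x) = c *\<^sub>C f x"
  shows "clinear f"
  using assms by (simp add: clinear_iff)

lemma clinear_add: "clinear f \<Longrightarrow> f (x + y) = f x + f y"
  and clinear_scale: "clinear f \<Longrightarrow> f (c *\<^sub>C x) = c *\<^sub>C f x"
  by (simp_all add: clinear_iff)

lemma clinear_0: "clinear f \<Longrightarrow> f 0 = 0"
  by (metis clinear_scale cvec.scale_zero_left)

lemma clinear_diff: "clinear f \<Longrightarrow> f (x - y) = f x - f y"
  by (metis add_diff_cancel clinear_add diff_add_cancel)

lemma clinear_neg: "clinear f \<Longrightarrow> f (- x) = - f x"
  by (metis clinear_0 clinear_diff diff_0)

lemma clinear_sum: "clinear f \<Longrightarrow> f (sum g A) = (\<Sum>x\<in>A. f (g x))"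
  by (induction A rule: infinite_finite_induct) (auto simp: clinear_0 clinear_add)

lemma clinear_compose: "clinear f \<Longrightarrow> clinear g \<Longrightarrow> clinear (\<lambda>x. f (g x))"
  by (simp add: clinear_iff)

lemma clinear_ident: "clinear (\<lambda>x. x)"
  by (simp add: clinear_iff)

lemma clinear_plus: "clinear f \<Longrightarrow> clinear g \<Longrightarrow> clinear (\<lambda>x. f x + g x)"
  by (simp add: clinear_iff cvec.scale_right_distrib algebra_simps)

lemma clinear_scaled: "clinear f \<Longrightarrow> clinear (\<lambda>x. c *\<^sub>C f x)"
  by (simp add: clinear_iff cvec.scale_right_distrib cvec.scale_left_commute)

lemma clinear_sum_fun: "(\<And>i. i \<in> I \<Longrightarrow> clinear (f i)) \<Longrightarrow> clinear (\<lambda>x. \<Sum>i\<in>I. f i x)"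
  by (induction I rule: infinite_finite_induct) (auto intro!: clinear_plus simp: clinear_iff[of "\<lambda>_. 0"])

lemma cbilinearI:
  "(\<And>x. clinear (f x)) \<Longrightarrow> (\<And>y. clinear (\<lambda>x. f x y)) \<Longrightarrow> cbilinear f"
  by (simp add: cbilinear_def)

lemma clinear_span_induct:
  assumes "x \<in> cspan S" and "clinear f" and "clinear g" and "\<And>s. s \<in> S \<Longrightarrow> f s = g s"
  shows "f x = g x"
  using assms(1)
proof (induction rule: cvec.span_induct_alt)
  case base
  then show ?case using assms by (simp add: clinear_0)
next
  case (step c x y)
  then show ?case using assms by (simp add: clinear_add clinear_scale)
qed

instantiation complex :: complex_vector
begin
definition scaleC_complex :: "complex \<Rightarrow> complex \<Rightarrow> complex"
  where "scaleC_complex c x = c * x"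
instance by standard (simp_all add: scaleC_complex_def algebra_simps)
end

instantiation poly_mapping :: (type, complex_vector) complex_vector
begin
lift_definition scaleC_poly_mapping :: "complex \<Rightarrow> ('a \<Rightarrow>\<^sub>0 'b) \<Rightarrow> ('a \<Rightarrow>\<^sub>0 'b)"
  is "\<lambda>c f x. c *\<^sub>C f x"
  by (erule finite_subset[rotated]) auto
instance
  by standard (transfer; simp add: fun_eq_iff scaleC_add_right scaleC_add_left scaleC_scaleC scaleC_one)+
end

lemma lookup_scaleC: "Poly_Mapping.lookup (c *\<^sub>C f) x = c *\<^sub>C Poly_Mapping.lookup f x"
  by transfer simp

text \<open>The type \<open>'a \<Rightarrow>\<^sub>0 complex\<close> is the free complex vector space on \<open>'a\<close>.\<close>

abbreviation basis :: "'a \<Rightarrow> 'a \<Rightarrow>\<^sub>0 complex"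
  where "basis x \<equiv> Poly_Mapping.single x 1"

definition linext :: "('a \<Rightarrow> 'b::complex_vector) \<Rightarrow> ('a \<Rightarrow>\<^sub>0 complex) \<Rightarrow> 'b"
  where "linext \<phi> f = (\<Sum>x\<in>Poly_Mapping.keys f. Poly_Mapping.lookup f x *\<^sub>C \<phi> x)"

definition conj_linext :: "('a \<Rightarrow> 'b::complex_vector) \<Rightarrow> ('a \<Rightarrow>\<^sub>0 complex) \<Rightarrow> 'b"
  where "conj_linext \<phi> f = (\<Sum>x\<in>Poly_Mapping.keys f. cnj (Poly_Mapping.lookup f x) *\<^sub>C \<phi> x)"

lemma linext_superset:
  assumes "finite A" "Poly_Mapping.keys f \<subseteq> A"
  shows "linext \<phi> f = (\<Sum>x\<in>A. Poly_Mapping.lookup f x *\<^sub>C \<phi> x)"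
  unfolding linext_def using assms
  by (intro sum.mono_neutral_left) (auto simp: in_keys_iff)

lemma conj_linext_superset:
  assumes "finite A" "Poly_Mapping.keys f \<subseteq> A"
  shows "conj_linext \<phi> f = (\<Sum>x\<in>A. cnj (Poly_Mapping.lookup f x) *\<^sub>C \<phi> x)"
  unfolding conj_linext_def using assms
  by (intro sum.mono_neutral_left) (auto simp: in_keys_iff)

lemma keys_scaleC: "Poly_Mapping.keys (c *\<^sub>C f) \<subseteq> Poly_Mapping.keys (f :: 'a \<Rightarrow>\<^sub>0 complex)"
  by (auto simp: in_keys_iff lookup_scaleC)

lemma clinear_linext: "clinear (linext \<phi>)"
proof (rule clinearI)
  fix f g :: "'a \<Rightarrow>\<^sub>0 complex" and c
  let ?A = "Poly_Mapping.keys f \<union> Poly_Mapping.keys g"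
  have "Poly_Mapping.keys (f + g) \<subseteq> ?A" by (rule Poly_Mapping.keys_add)
  then show "linext \<phi> (f + g) = linext \<phi> f + linext \<phi> g"
    by (simp add: linext_superset[of ?A] lookup_add cvec.scale_left_distrib sum.distrib)
  show "linext \<phi> (c *\<^sub>C f) = c *\<^sub>C linext \<phi> f"
    using keys_scaleC[of c f]
    by (simp add: linext_superset[of "Poly_Mapping.keys f"] lookup_scaleC scaleC_complex_def
        cvec.scale_sum_right)
qed

lemma conj_linext_add: "conj_linext \<phi> (f + g) = conj_linext \<phi> f + conj_linext \<phi> g"
proof -
  let ?A = "Poly_Mapping.keys f \<union> Poly_Mapping.keys g"
  have "Poly_Mapping.keys (f + g) \<subseteq> ?A" by (rule Poly_Mapping.keys_add)
  then show ?thesis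
    by (simp add: conj_linext_superset[of ?A] lookup_add cvec.scale_left_distrib sum.distrib)
qed

lemma conj_linext_scale: "conj_linext \<phi> (c *\<^sub>C f) = cnj c *\<^sub>C conj_linext \<phi> f"
  using keys_scaleC[of c f]
  by (simp add: conj_linext_superset[of "Poly_Mapping.keys f"] lookup_scaleC scaleC_complex_def
        cvec.scale_sum_right)

lemma conj_linext_minus: "conj_linext \<phi> (f - g) = conj_linext \<phi> f - conj_linext \<phi> g"
  by (metis add_diff_cancel conj_linext_add diff_add_cancel)

lemma linext_basis [simp]: "linext \<phi> (basis x) = \<phi> x"
  and conj_linext_basis [simp]: "conj_linext \<phi> (basis x) = \<phi> x"
  by (simp_all add: linext_def conj_linext_def)

lemma free_vector_in_span: "f \<in> cspan (range basis)"
proof -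
  have "f = (\<Sum>x\<in>Poly_Mapping.keys f. Poly_Mapping.lookup f x *\<^sub>C basis x)"
    by (rule poly_mapping_eqI)
      (auto simp: lookup_sum lookup_scaleC lookup_single scaleC_complex_def when_def in_keys_iff
        if_distrib[of "\<lambda>u. _ * u"] cong: if_cong)
  also have "\<dots> \<in> cspan (range basis)"
    by (intro cvec.span_sum cvec.span_scale cvec.span_base) auto
  finally show ?thesis .
qed

section \<open>The tensor product of complex vector spaces\<close>

definition bilinear_relators ::
    "(('a::complex_vector \<times> 'b::complex_vector) \<Rightarrow>\<^sub>0 complex) set"
  where "bilinear_relators =
     {basis (x + x', y) - (basis (x, y) + basis (x', y)) | x x' y. True}
   \<union> {basis (x, y + y') - (basis (x, y) + basis (x, y')) | x y y'. True}
   \<union> {basis (c *\<^sub>C x, y) - c *\<^sub>C basis (x, y) | c x y. True}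
   \<union> {basis (x, c *\<^sub>C y) - c *\<^sub>C basis (x, y) | c x y. True}"

definition tensor_rel where "tensor_rel f g \<longleftrightarrow> f - g \<in> cspan bilinear_relators"

quotient_type (overloaded) ('a, 'b) tensor =
    "('a::complex_vector \<times> 'b::complex_vector) \<Rightarrow>\<^sub>0 complex" / tensor_rel
proof (rule equivpI)
  show "reflp tensor_rel"
    by (simp add: reflp_def tensor_rel_def cvec.span_zero)
  show "symp tensor_rel"
    unfolding symp_def tensor_rel_def by (metis cvec.span_neg minus_diff_eq)
  show "transp tensor_rel"
    unfolding transp_def tensor_rel_def by (auto dest: cvec.span_add)
qed

instantiation tensor :: (complex_vector, complex_vector) complex_vector
begin

lift_definition zero_tensor :: "('a, 'b) tensor" is 0 .

lift_definition plus_tensor :: "('a, 'b) tensor \<Rightarrow> ('a, 'b) tensor \<Rightarrow> ('a, 'b) tensor" is "(+)"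
  unfolding tensor_rel_def by (drule (1) cvec.span_add) (simp add: algebra_simps)

lift_definition minus_tensor :: "('a, 'b) tensor \<Rightarrow> ('a, 'b) tensor \<Rightarrow> ('a, 'b) tensor" is "(-)"
  unfolding tensor_rel_def by (drule (1) cvec.span_diff) (simp add: algebra_simps)

lift_definition uminus_tensor :: "('a, 'b) tensor \<Rightarrow> ('a, 'b) tensor" is "uminus"
  unfolding tensor_rel_def by (drule cvec.span_neg) (simp add: algebra_simps)

lift_definition scaleC_tensor :: "complex \<Rightarrow> ('a, 'b) tensor \<Rightarrow> ('a, 'b) tensor" is "scaleC"
  unfolding tensor_rel_def by (simp add: cvec.span_scale flip: cvec.scale_right_diff_distrib)

instance
proof
  fix x y z :: "('a, 'b) tensor" and a b :: complex
  note refl = equivp_reflp[OF tensor_equivp]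
  show "x + y + z = x + (y + z)" by transfer (simp add: refl add.assoc)
  show "x + y = y + x" by transfer (simp add: refl add.commute)
  show "0 + x = x" by transfer (simp add: refl)
  show "- x + x = 0" by transfer (simp add: refl)
  show "x - y = x + - y" by transfer (simp add: refl)
  show "a *\<^sub>C (x + y) = a *\<^sub>C x + a *\<^sub>C y" by transfer (simp add: refl cvec.scale_right_distrib)
  show "(a + b) *\<^sub>C x = a *\<^sub>C x + b *\<^sub>C x" by transfer (simp add: refl cvec.scale_left_distrib)
  show "a *\<^sub>C b *\<^sub>C x = (a * b) *\<^sub>C x" by transfer (simp add: refl)
  show "1 *\<^sub>C x = x" by transfer (simp add: refl)
qed

end

lift_definition pure_tensor :: "'a::complex_vector \<Rightarrow> 'b::complex_vector \<Rightarrow> ('a, 'b) tensor"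
    (infixl "\<otimes>" 70)
  is "\<lambda>x y. basis (x, y)" .

text \<open>The linear map on the tensor product induced by a bilinear map; only meaningful if \<open>\<phi>\<close> is
  bilinear.  A \<open>\<phi>\<close> that is biadditive and conjugate homogeneous in both arguments
  induces a conjugate linear map.\<close>

definition tlift ::
    "('a::complex_vector \<Rightarrow> 'b::complex_vector \<Rightarrow> 'c::complex_vector) \<Rightarrow> ('a, 'b) tensor \<Rightarrow> 'c"
  where "tlift \<phi> t = linext (\<lambda>(x, y). \<phi> x y) (rep_tensor t)"

definition conj_tlift ::
    "('a::complex_vector \<Rightarrow> 'b::complex_vector \<Rightarrow> 'c::complex_vector) \<Rightarrow> ('a, 'b) tensor \<Rightarrow> 'c"
  where "conj_tlift \<phi> t = conj_linext (\<lambda>(x, y). \<phi> x y) (rep_tensor t)"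

lemma rep_abs_tensor: "rep_tensor (abs_tensor f) - f \<in> cspan bilinear_relators"
proof -
  have "tensor_rel (rep_tensor (abs_tensor f)) f"
    by (rule Quotient3_rep_abs[OF Quotient3_tensor]) (simp add: tensor_rel_def cvec.span_zero)
  then show ?thesis by (simp add: tensor_rel_def)
qed

lemma linext_relators:
  fixes \<phi> :: "'a::complex_vector \<Rightarrow> 'b::complex_vector \<Rightarrow> 'c::complex_vector"
  assumes "cbilinear \<phi>" "f \<in> cspan bilinear_relators"
  shows "linext (\<lambda>(x, y). \<phi> x y) f = 0"
proof -
  have "linext (\<lambda>(x, y). \<phi> x y) s = 0" if "s \<in> bilinear_relators" for s
    using that assms(1) unfolding bilinear_relators_def cbilinear_def clinear_iff
    by (auto simp: clinear_diff[OF clinear_linext] clinear_add[OF clinear_linext]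
        clinear_scale[OF clinear_linext])
  moreover have "clinear (\<lambda>_ :: ('a \<times> 'b) \<Rightarrow>\<^sub>0 complex. 0 :: 'c)" by (simp add: clinear_iff)
  ultimately show ?thesis
    using clinear_span_induct[OF assms(2) clinear_linext, of "\<lambda>_. 0"] by blast
qed

lemma tlift_abs: "cbilinear \<phi> \<Longrightarrow> tlift \<phi> (abs_tensor f) = linext (\<lambda>(x, y). \<phi> x y) f"
  unfolding tlift_def
  by (metis rep_abs_tensor linext_relators clinear_diff[OF clinear_linext] eq_iff_diff_eq_0)

lemma tlift_pure [simp]: "cbilinear \<phi> \<Longrightarrow> tlift \<phi> (x \<otimes> y) = \<phi> x y"
  by (simp add: pure_tensor.abs_eq tlift_abs)

lemma clinear_tlift:
  fixes \<phi> :: "'a::complex_vector \<Rightarrow> 'b::complex_vector \<Rightarrow> 'c::complex_vector"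
  assumes "cbilinear \<phi>"
  shows "clinear (tlift \<phi>)"
proof (rule clinearI)
  fix s t :: "('a, 'b) tensor" and c
  obtain f g where "s = abs_tensor f" "t = abs_tensor g"
    by (metis Quotient3_abs_rep[OF Quotient3_tensor])
  then show "tlift \<phi> (s + t) = tlift \<phi> s + tlift \<phi> t" "tlift \<phi> (c *\<^sub>C s) = c *\<^sub>C tlift \<phi> s"
    using assms by (simp_all add: plus_tensor.abs_eq scaleC_tensor.abs_eq tlift_abs
        clinear_add[OF clinear_linext] clinear_scale[OF clinear_linext])
qed

definition conj_bilinear :: "('a::complex_vector \<Rightarrow> 'b::complex_vector \<Rightarrow> 'c::complex_vector) \<Rightarrow> bool"
  where "conj_bilinear \<phi> \<longleftrightarrow>
    (\<forall>x x' y. \<phi> (x + x') y = \<phi> x y + \<phi> x' y) \<and> (\<forall>x y y'. \<phi> x (y + y') = \<phi> x y + \<phi> x y') \<and>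
    (\<forall>c x y. \<phi> (c *\<^sub>C x) y = cnj c *\<^sub>C \<phi> x y) \<and> (\<forall>c x y. \<phi> x (c *\<^sub>C y) = cnj c *\<^sub>C \<phi> x y)"

lemma conj_linext_relators:
  assumes "conj_bilinear \<phi>" "f \<in> cspan bilinear_relators"
  shows "conj_linext (\<lambda>(x, y). \<phi> x y) f = 0"
  using assms(2)
proof (induction rule: cvec.span_induct_alt)
  case base
  show ?case by (simp add: conj_linext_def)
next
  case (step c s y)
  have "conj_linext (\<lambda>(x, y). \<phi> x y) s = 0"
    using step(1) assms(1) unfolding bilinear_relators_def conj_bilinear_def
    by (auto simp: conj_linext_minus conj_linext_add conj_linext_scale)
  then show ?case using step by (simp add: conj_linext_add conj_linext_scale)
qed

lemma conj_tlift_abs: "conj_bilinear \<phi> \<Longrightarrow> conj_tlift \<phi> (abs_tensor f) = conj_linext (\<lambda>(x, y). \<phi> x y) f"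
  unfolding conj_tlift_def
  by (metis rep_abs_tensor conj_linext_relators conj_linext_minus eq_iff_diff_eq_0)

lemma conj_tlift_pure [simp]: "conj_bilinear \<phi> \<Longrightarrow> conj_tlift \<phi> (x \<otimes> y) = \<phi> x y"
  by (simp add: pure_tensor.abs_eq conj_tlift_abs)

lemma
  fixes \<phi> :: "'a::complex_vector \<Rightarrow> 'b::complex_vector \<Rightarrow> 'c::complex_vector"
  assumes "conj_bilinear \<phi>"
  shows conj_tlift_add: "conj_tlift \<phi> (s + t) = conj_tlift \<phi> s + conj_tlift \<phi> t"
    and conj_tlift_scale: "conj_tlift \<phi> (c *\<^sub>C s) = cnj c *\<^sub>C conj_tlift \<phi> s"
proof -
  obtain f g where "s = abs_tensor f" "t = abs_tensor g"
    by (metis Quotient3_abs_rep[OF Quotient3_tensor])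
  then show "conj_tlift \<phi> (s + t) = conj_tlift \<phi> s + conj_tlift \<phi> t"
    "conj_tlift \<phi> (c *\<^sub>C s) = cnj c *\<^sub>C conj_tlift \<phi> s"
    using assms by (simp_all add: plus_tensor.abs_eq scaleC_tensor.abs_eq conj_tlift_abs
        conj_linext_add conj_linext_scale)
qed

lemma cbilinear_pure_tensor: "cbilinear ((\<otimes>) :: 'a::complex_vector \<Rightarrow> 'b::complex_vector \<Rightarrow> _)"
proof -
  have eqI: "abs_tensor f = abs_tensor g" if "f - g \<in> bilinear_relators"
    for f g :: "('a \<times> 'b) \<Rightarrow>\<^sub>0 complex"
    using that by (simp add: tensor.abs_eq_iff tensor_rel_def cvec.span_base)
  have "(x + x') \<otimes> y = x \<otimes> y + x' \<otimes> y" for x x' :: 'a and y :: 'b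
    unfolding pure_tensor.abs_eq plus_tensor.abs_eq
    by (rule eqI) (unfold bilinear_relators_def, blast)
  moreover have "x \<otimes> (y + y') = x \<otimes> y + x \<otimes> y'" for x :: 'a and y y' :: 'b
    unfolding pure_tensor.abs_eq plus_tensor.abs_eq
    by (rule eqI) (unfold bilinear_relators_def, blast)
  moreover have "(c *\<^sub>C x) \<otimes> y = c *\<^sub>C (x \<otimes> y)" for c and x :: 'a and y :: 'b
    unfolding pure_tensor.abs_eq scaleC_tensor.abs_eq
    by (rule eqI) (unfold bilinear_relators_def, blast)
  moreover have "x \<otimes> (c *\<^sub>C y) = c *\<^sub>C (x \<otimes> y)" for c and x :: 'a and y :: 'b
    unfolding pure_tensor.abs_eq scaleC_tensor.abs_eq
    by (rule eqI) (unfold bilinear_relators_def, blast)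
  ultimately show ?thesis by (simp add: cbilinear_def clinear_iff)
qed

lemma tensor_add_left: "(x + x') \<otimes> y = x \<otimes> y + x' \<otimes> y"
  and tensor_add_right: "x \<otimes> (y + y') = x \<otimes> y + x \<otimes> y'"
  and tensor_scale_left: "(c *\<^sub>C x) \<otimes> y = c *\<^sub>C (x \<otimes> y)"
  and tensor_scale_right: "x \<otimes> (c *\<^sub>C y) = c *\<^sub>C (x \<otimes> y)"
  using cbilinear_pure_tensor[where 'a = 'a and 'b = 'b] by (simp_all add: cbilinear_def clinear_iff)

lemma clinear_tensor_left: "clinear f \<Longrightarrow> clinear (\<lambda>x. f x \<otimes> y)"
  and clinear_tensor_right: "clinear f \<Longrightarrow> clinear (\<lambda>x. y \<otimes> f x)"
  by (simp_all add: clinear_iff tensor_add_left tensor_add_right tensor_scale_left tensor_scale_right)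

lemma tensor_in_span: "t \<in> cspan {x \<otimes> y | x y. True}"
proof -
  obtain f where t: "t = abs_tensor f"
    by (metis Quotient3_abs_rep[OF Quotient3_tensor])
  have "abs_tensor f \<in> cspan {x \<otimes> y | x y. True}"
    using free_vector_in_span[of f]
  proof (induction rule: cvec.span_induct_alt)
    case base
    then show ?case by (simp add: cvec.span_zero flip: zero_tensor.abs_eq)
  next
    case (step c s f)
    then obtain x y where "s = basis (x, y)" by auto
    then have "abs_tensor s = x \<otimes> y" by (simp add: pure_tensor.abs_eq)
    then have "abs_tensor s \<in> cspan {x \<otimes> y | x y. True}" by (auto intro: cvec.span_base)
    then show ?case using step
      by (simp add: cvec.span_add cvec.span_scale flip: plus_tensor.abs_eq scaleC_tensor.abs_eq)
  qed
  then show ?thesis using t by simp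
qed

lemma tensor_linear_eqI:
  assumes "clinear f" "clinear g" "\<And>x y. f (x \<otimes> y) = g (x \<otimes> y)"
  shows "f t = g t"
  using clinear_span_induct[OF tensor_in_span assms(1,2)] assms(3) by blast

definition tmap ::
    "('a::complex_vector \<Rightarrow> 'c::complex_vector) \<Rightarrow> ('b::complex_vector \<Rightarrow> 'd::complex_vector)
      \<Rightarrow> ('a, 'b) tensor \<Rightarrow> ('c, 'd) tensor"
  where "tmap f g = tlift (\<lambda>x y. f x \<otimes> g y)"

definition tassoc ::
    "(('a::complex_vector, 'b::complex_vector) tensor, 'c::complex_vector) tensor
      \<Rightarrow> ('a, ('b, 'c) tensor) tensor"
  where "tassoc = tlift (\<lambda>t z. tlift (\<lambda>x y. x \<otimes> (y \<otimes> z)) t)"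

definition tflip :: "('a::complex_vector, 'b::complex_vector) tensor \<Rightarrow> ('b, 'a) tensor"
  where "tflip = tlift (\<lambda>x y. y \<otimes> x)"

text \<open>For subspaces \<open>V\<close> and \<open>W\<close>, the image of \<open>V \<otimes> W\<close> (the inclusion is injective over a field).\<close>

definition tensor_of :: "'a::complex_vector set \<Rightarrow> 'b::complex_vector set \<Rightarrow> ('a, 'b) tensor set"
  where "tensor_of V W = cspan {x \<otimes> y | x y. x \<in> V \<and> y \<in> W}"

section \<open>Graded differential star-algebras\<close>

text \<open>Units are not required to be nonzero, so the zero algebra is allowed.\<close>

class complex_algebra = complex_vector + ring + monoid_mult +
  assumes mult_scaleC_left: "(c *\<^sub>C x) * y = c *\<^sub>C (x * y)"
    and mult_scaleC_right: "x * (c *\<^sub>C y) = c *\<^sub>C (x * y)"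

text \<open>\<open>homog n\<close> is the homogeneous part of degree \<open>n\<close>; the whole type is the direct sum of these.\<close>

class graded_diff_star_algebra = complex_algebra +
  fixes homog :: "nat \<Rightarrow> 'a set"
    and dif :: "'a \<Rightarrow> 'a"
    and star :: "'a \<Rightarrow> 'a"
  assumes homog_0: "0 \<in> homog n"
    and homog_add: "x \<in> homog n \<Longrightarrow> y \<in> homog n \<Longrightarrow> x + y \<in> homog n"
    and homog_scaleC: "x \<in> homog n \<Longrightarrow> c *\<^sub>C x \<in> homog n"
    and homog_direct_sum: "\<exists>!c. (\<forall>n. c n \<in> homog n) \<and> finite {n. c n \<noteq> 0} \<and>
          x = (\<Sum>n | c n \<noteq> 0. c n)"
    and homog_one: "1 \<in> homog 0"
    and homog_mult: "x \<in> homog m \<Longrightarrow> y \<in> homog n \<Longrightarrow> x * y \<in> homog (m + n)"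
    and dif_add: "dif (x + y) = dif x + dif y"
    and dif_scaleC: "dif (c *\<^sub>C x) = c *\<^sub>C dif x"
    and dif_homog: "x \<in> homog n \<Longrightarrow> dif x \<in> homog (Suc n)"
    and dif_dif: "dif (dif x) = 0"
    and dif_mult: "x \<in> homog n \<Longrightarrow> dif (x * y) = dif x * y + (-1) ^ n *\<^sub>C (x * dif y)"
    and star_add: "star (x + y) = star x + star y"
    and star_scaleC: "star (c *\<^sub>C x) = cnj c *\<^sub>C star x"
    and star_star: "star (star x) = x"
    and star_homog: "x \<in> homog n \<Longrightarrow> star x \<in> homog n"
    and star_mult: "x \<in> homog m \<Longrightarrow> y \<in> homog n \<Longrightarrow>
          star (x * y) = (-1) ^ (m * n) *\<^sub>C (star y * star x)"
    and dif_star: "dif (star x) = star (dif x)"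

definition homog_parts :: "'a::graded_diff_star_algebra \<Rightarrow> nat \<Rightarrow>\<^sub>0 'a"
  where "homog_parts x = (THE c. (\<forall>n. Poly_Mapping.lookup c n \<in> homog n) \<and>
          x = (\<Sum>n\<in>Poly_Mapping.keys c. Poly_Mapping.lookup c n))"

text \<open>Linear extension of a family of linear maps, the \<open>n\<close>-th one given on degree \<open>n\<close>.\<close>

definition graded_ext ::
    "(nat \<Rightarrow> 'a::graded_diff_star_algebra \<Rightarrow> 'b::complex_vector) \<Rightarrow> 'a \<Rightarrow> 'b"
  where "graded_ext L x =
    (\<Sum>n\<in>Poly_Mapping.keys (homog_parts x). L n (Poly_Mapping.lookup (homog_parts x) n))"

lemma homog_subspace: "csubspace (homog n)"
  by (simp add: cvec.subspace_def homog_0 homog_add homog_scaleC)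

lemma homog_decomposition:
  "\<exists>!c. (\<forall>n. Poly_Mapping.lookup c n \<in> homog n) \<and>
     x = (\<Sum>n\<in>Poly_Mapping.keys c. Poly_Mapping.lookup c n)"
proof -
  from ex1_implies_ex[OF homog_direct_sum[of x]]
  obtain c where c: "\<forall>n. c n \<in> homog n" "finite {n. c n \<noteq> 0}" "x = (\<Sum>n | c n \<noteq> 0. c n)"
    by blast
  show ?thesis
  proof (rule ex1I[of _ "Abs_poly_mapping c"])
    show "(\<forall>n. Poly_Mapping.lookup (Abs_poly_mapping c) n \<in> homog n) \<and>
      x = (\<Sum>n\<in>Poly_Mapping.keys (Abs_poly_mapping c). Poly_Mapping.lookup (Abs_poly_mapping c) n)"
      using c unfolding keys.rep_eq by simp
  next
    fix c' assume "(\<forall>n. Poly_Mapping.lookup c' n \<in> homog n) \<and>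
      x = (\<Sum>n\<in>Poly_Mapping.keys c'. Poly_Mapping.lookup c' n)"
    then have "Poly_Mapping.lookup c' = c"
      unfolding keys.rep_eq using ex1E[OF homog_direct_sum[of x]] c finite_lookup by metis
    then show "c' = Abs_poly_mapping c" by (metis lookup_inverse)
  qed
qed

lemma homog_parts:
  "Poly_Mapping.lookup (homog_parts x) n \<in> homog n"
  "(\<Sum>n\<in>Poly_Mapping.keys (homog_parts x). Poly_Mapping.lookup (homog_parts x) n) = x"
  using theI'[OF homog_decomposition[of x]] unfolding homog_parts_def[symmetric] by auto

lemma homog_parts_unique:
  assumes "\<And>n. Poly_Mapping.lookup c n \<in> homog n"
    and "x = (\<Sum>n\<in>Poly_Mapping.keys c. Poly_Mapping.lookup c n)"
  shows "homog_parts x = c"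
  unfolding homog_parts_def using assms by (intro the1_equality homog_decomposition) auto

lemma sum_lookup_superset:
  assumes "finite A" "Poly_Mapping.keys c \<subseteq> A" "\<And>n. L n 0 = 0"
  shows "(\<Sum>n\<in>Poly_Mapping.keys c. L n (Poly_Mapping.lookup c n)) = (\<Sum>n\<in>A. L n (Poly_Mapping.lookup c n))"
  using assms by (intro sum.mono_neutral_left) (auto simp: in_keys_iff)

lemma homog_parts_add: "homog_parts (x + y) = homog_parts x + homog_parts y"
proof (rule homog_parts_unique)
  let ?A = "Poly_Mapping.keys (homog_parts x) \<union> Poly_Mapping.keys (homog_parts y)"
  have *: "Poly_Mapping.keys (homog_parts x + homog_parts y) \<subseteq> ?A" by (rule Poly_Mapping.keys_add)
  show "Poly_Mapping.lookup (homog_parts x + homog_parts y) n \<in> homog n" for n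
    by (simp add: lookup_add homog_parts cvec.subspace_add homog_subspace)
  have "x + y = (\<Sum>n\<in>?A. Poly_Mapping.lookup (homog_parts x) n) + (\<Sum>n\<in>?A. Poly_Mapping.lookup (homog_parts y) n)"
    by (subst (1 2) sum_lookup_superset[where L = "\<lambda>_ x. x", symmetric]) (auto simp: homog_parts)
  then show "x + y = (\<Sum>n\<in>Poly_Mapping.keys (homog_parts x + homog_parts y).
      Poly_Mapping.lookup (homog_parts x + homog_parts y) n)"
    by (subst sum_lookup_superset[where L = "\<lambda>_ x. x", OF _ *]) (auto simp: lookup_add sum.distrib)
qed

lemma homog_parts_scaleC: "homog_parts (c *\<^sub>C x) = c *\<^sub>C homog_parts x"
proof (rule homog_parts_unique)
  let ?A = "Poly_Mapping.keys (homog_parts x)"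
  have *: "Poly_Mapping.keys (c *\<^sub>C homog_parts x) \<subseteq> ?A"
    by (auto simp: in_keys_iff lookup_scaleC)
  show "Poly_Mapping.lookup (c *\<^sub>C homog_parts x) n \<in> homog n" for n
    by (simp add: lookup_scaleC homog_parts cvec.subspace_scale homog_subspace)
  show "c *\<^sub>C x = (\<Sum>n\<in>Poly_Mapping.keys (c *\<^sub>C homog_parts x). Poly_Mapping.lookup (c *\<^sub>C homog_parts x) n)"
    by (subst sum_lookup_superset[where L = "\<lambda>_ x. x", OF _ *])
      (auto simp: lookup_scaleC homog_parts simp flip: cvec.scale_sum_right)
qed

lemma homog_parts_homog:
  assumes "x \<in> homog n"
  shows "homog_parts x = Poly_Mapping.single n x"
proof (rule homog_parts_unique)
  show "Poly_Mapping.lookup (Poly_Mapping.single n x) k \<in> homog k" for k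
    using assms by (auto simp: lookup_single when_def cvec.subspace_0 homog_subspace)
qed simp

lemma clinear_graded_ext:
  assumes "\<And>n. clinear (L n)"
  shows "clinear (graded_ext L)"
proof (rule clinearI)
  have 0: "L n 0 = 0" for n using assms clinear_0 by blast
  fix x y :: 'a and c
  let ?A = "Poly_Mapping.keys (homog_parts x) \<union> Poly_Mapping.keys (homog_parts y)"
  have *: "Poly_Mapping.keys (homog_parts x + homog_parts y) \<subseteq> ?A" by (rule Poly_Mapping.keys_add)
  show "graded_ext L (x + y) = graded_ext L x + graded_ext L y"
    unfolding graded_ext_def homog_parts_add
    by (subst (1 2 3) sum_lookup_superset[where A = ?A])
      (use * in \<open>auto simp: 0 lookup_add clinear_add[OF assms] sum.distrib\<close>)
  have *: "Poly_Mapping.keys (c *\<^sub>C homog_parts x) \<subseteq> Poly_Mapping.keys (homog_parts x)"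
    by (auto simp: in_keys_iff lookup_scaleC)
  show "graded_ext L (c *\<^sub>C x) = c *\<^sub>C graded_ext L x"
    unfolding graded_ext_def homog_parts_scaleC
    by (subst sum_lookup_superset[where A = "Poly_Mapping.keys (homog_parts x)"])
      (use * in \<open>auto simp: 0 lookup_scaleC clinear_scale[OF assms] cvec.scale_sum_right\<close>)
qed

lemma graded_ext_homog: "x \<in> homog n \<Longrightarrow> L n 0 = 0 \<Longrightarrow> graded_ext L x = L n x"
  by (auto simp: graded_ext_def homog_parts_homog)

lemma homog_span: "x \<in> cspan (\<Union>n. homog n)"
proof -
  have "(\<Sum>n\<in>Poly_Mapping.keys (homog_parts x). Poly_Mapping.lookup (homog_parts x) n) \<in> cspan (\<Union>n. homog n)"
    by (intro cvec.span_sum cvec.span_base) (use homog_parts in blast)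
  then show ?thesis by (simp add: homog_parts)
qed

lemma clinear_left_mult: "clinear f \<Longrightarrow> clinear (\<lambda>x. (a :: _::complex_algebra) * f x)"
  and clinear_right_mult: "clinear f \<Longrightarrow> clinear (\<lambda>x. f x * (a :: _::complex_algebra))"
  by (simp_all add: clinear_iff algebra_simps mult_scaleC_left mult_scaleC_right)

lemma clinear_dif: "clinear dif"
  by (simp add: clinear_iff dif_add dif_scaleC)

lemma cspan_homog_tensor:
  fixes t :: "('a::graded_diff_star_algebra, 'b::graded_diff_star_algebra) tensor"
  shows "t \<in> cspan {x \<otimes> y | x y. \<exists>i j. x \<in> homog i \<and> y \<in> homog j}" (is "_ \<in> cspan ?S")
proof -
  have 1: "x \<otimes> y \<in> cspan ?S" if "x \<in> homog i" for x :: 'a and y :: 'b and i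
    using homog_span[of y]
  proof (induction rule: cvec.span_induct_alt)
    case base
    show ?case by (simp add: clinear_0[OF clinear_tensor_right[OF clinear_ident]] cvec.span_zero)
  next
    case (step c u v)
    then have "x \<otimes> u \<in> cspan ?S" using that by (intro cvec.span_base) blast
    then show ?case
      using step by (simp add: tensor_add_right tensor_scale_right cvec.span_add cvec.span_scale)
  qed
  have 2: "x \<otimes> y \<in> cspan ?S" for x :: 'a and y :: 'b
    using homog_span[of x]
  proof (induction rule: cvec.span_induct_alt)
    case base
    show ?case by (simp add: clinear_0[OF clinear_tensor_left[OF clinear_ident]] cvec.span_zero)
  next
    case (step c u v)
    then have "u \<otimes> y \<in> cspan ?S" using 1 by blast
    then show ?case
      using step by (simp add: tensor_add_left tensor_scale_left cvec.span_add cvec.span_scale)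
  qed
  have "cspan {x \<otimes> y | (x :: 'a) (y :: 'b). True} \<subseteq> cspan ?S"
    by (rule cvec.span_minimal) (use 2 in \<open>auto simp: cvec.subspace_span\<close>)
  then show ?thesis using tensor_in_span by blast
qed

lemma tensor_homog_eqI:
  fixes f :: "('a::graded_diff_star_algebra, 'b::graded_diff_star_algebra) tensor \<Rightarrow> 'c::complex_vector"
  assumes "clinear f" "clinear g"
    and "\<And>x y i j. x \<in> homog i \<Longrightarrow> y \<in> homog j \<Longrightarrow> f (x \<otimes> y) = g (x \<otimes> y)"
  shows "f t = g t"
  using clinear_span_induct[OF cspan_homog_tensor assms(1,2)] assms(3) by blast

lemma tlift_plus_fun: "tlift (\<lambda>x y. \<phi> x y + \<psi> x y) t = tlift \<phi> t + tlift \<psi> t"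
  by (simp add: tlift_def linext_def split_beta cvec.scale_right_distrib sum.distrib)

lemma tlift_scale_fun: "tlift (\<lambda>x y. c *\<^sub>C \<phi> x y) t = c *\<^sub>C tlift \<phi> t"
  by (simp add: tlift_def linext_def split_beta cvec.scale_sum_right mult.commute)

lemma graded_ext_plus_fun: "graded_ext (\<lambda>n x. L n x + M n x) x = graded_ext L x + graded_ext M x"
  and graded_ext_scale_fun: "graded_ext (\<lambda>n x. c *\<^sub>C L n x) x = c *\<^sub>C graded_ext L x"
  by (simp_all add: graded_ext_def sum.distrib cvec.scale_sum_right)

text \<open>The tensor product of graded differential star-algebras, with Koszul signs in the product
  and the differential; see the lemmas \<open>tensor_mult_homog\<close>, \<open>tensor_dif_homog\<close> and
  \<open>tensor_star_pure\<close> below for the values on homogeneous elements.\<close>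

definition koszul_mult ::
    "'a::graded_diff_star_algebra \<Rightarrow> 'b::graded_diff_star_algebra \<Rightarrow> 'a \<Rightarrow> 'b \<Rightarrow> ('a, 'b) tensor"
  where "koszul_mult x y x' y' =
    graded_ext (\<lambda>i u. graded_ext (\<lambda>j v. (-1) ^ (i * j) *\<^sub>C ((x * v) \<otimes> (u * y'))) x') y"

definition koszul_dif ::
    "'a::graded_diff_star_algebra \<Rightarrow> 'b::graded_diff_star_algebra \<Rightarrow> ('a, 'b) tensor"
  where "koszul_dif x y = dif x \<otimes> y + graded_ext (\<lambda>i u. (-1) ^ i *\<^sub>C (u \<otimes> dif y)) x"

lemma cbilinear_koszul_mult: "cbilinear (koszul_mult x y)"
proof (rule cbilinearI)
  fix x' :: 'a and y' :: 'b
  show "clinear (koszul_mult x y x')"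
    by (rule clinearI)
      (simp_all add: koszul_mult_def distrib_left tensor_add_right mult_scaleC_right
        tensor_scale_right cvec.scale_right_distrib graded_ext_plus_fun
        cvec.scale_left_commute[of "(-1) ^ _"] graded_ext_scale_fun del: cvec.scale_scale)
  have "clinear (\<lambda>x'. graded_ext (\<lambda>j v. (- 1) ^ (i * j) *\<^sub>C (x * v \<otimes> (u * y'))) x')" for i u
    by (intro clinear_graded_ext clinear_scaled clinear_tensor_left clinear_left_mult clinear_ident)
  then show "clinear (\<lambda>x'. koszul_mult x y x' y')"
    unfolding koszul_mult_def graded_ext_def[where x = y] by (intro clinear_sum_fun)
qed

lemma koszul_mult_add1: "koszul_mult (x + x2) y x' y' = koszul_mult x y x' y' + koszul_mult x2 y x' y'"
  and koszul_mult_scale1: "koszul_mult (c *\<^sub>C x) y x' y' = c *\<^sub>C koszul_mult x y x' y'"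
  by (simp_all add: koszul_mult_def distrib_right tensor_add_left mult_scaleC_left
        tensor_scale_left cvec.scale_right_distrib graded_ext_plus_fun
        cvec.scale_left_commute[of "(-1) ^ _"] graded_ext_scale_fun del: cvec.scale_scale)

lemma clinear_koszul_mult2: "clinear (\<lambda>y. koszul_mult x y x' y')"
  unfolding koszul_mult_def
proof (intro clinear_graded_ext)
  fix n
  show "clinear (\<lambda>u. graded_ext (\<lambda>j v. (- 1) ^ (n * j) *\<^sub>C (x * v \<otimes> (u * y'))) x')"
    unfolding graded_ext_def
    by (intro clinear_sum_fun clinear_scaled clinear_tensor_right clinear_right_mult clinear_ident)
qed

lemma koszul_mult_fun:
  "koszul_mult (x + x2) y = (\<lambda>x' y'. koszul_mult x y x' y' + koszul_mult x2 y x' y')"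
  "koszul_mult (c *\<^sub>C x) y = (\<lambda>x' y'. c *\<^sub>C koszul_mult x y x' y')"
  "koszul_mult x (y + y2) = (\<lambda>x' y'. koszul_mult x y x' y' + koszul_mult x y2 x' y')"
  "koszul_mult x (c *\<^sub>C y) = (\<lambda>x' y'. c *\<^sub>C koszul_mult x y x' y')"
  by (intro ext, simp only: koszul_mult_add1 koszul_mult_scale1
      clinear_add[OF clinear_koszul_mult2] clinear_scale[OF clinear_koszul_mult2])+

lemma cbilinear_mult_outer: "cbilinear (\<lambda>x y. tlift (koszul_mult x y) t)"
  by (intro cbilinearI clinearI) (simp_all only: koszul_mult_fun tlift_plus_fun tlift_scale_fun)

lemma cbilinear_koszul_dif: "cbilinear koszul_dif"
proof (rule cbilinearI)
  show "clinear (koszul_dif x)" for x :: 'a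
    unfolding koszul_dif_def graded_ext_def
    by (intro clinear_plus clinear_sum_fun clinear_scaled clinear_tensor_right clinear_dif clinear_ident)
  show "clinear (\<lambda>x. koszul_dif x y)" for y :: 'b
    unfolding koszul_dif_def
    by (intro clinear_plus clinear_graded_ext clinear_scaled clinear_tensor_left clinear_dif clinear_ident)
qed

lemma conj_bilinear_star_tensor: "conj_bilinear (\<lambda>x y. star x \<otimes> star y)"
  by (simp add: conj_bilinear_def star_add star_scaleC tensor_add_left tensor_add_right
      tensor_scale_left tensor_scale_right)

lemma koszul_mult_homog:
  "y \<in> homog i \<Longrightarrow> x' \<in> homog j \<Longrightarrow>
    koszul_mult x y x' y' = (-1) ^ (i * j) *\<^sub>C ((x * x') \<otimes> (y * y'))"
  by (simp add: koszul_mult_def graded_ext_homog clinear_0[OF clinear_tensor_left[OF clinear_ident]]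
      clinear_0[OF clinear_tensor_right[OF clinear_ident]] graded_ext_def[where L = "\<lambda>_ _. 0"])

lemma koszul_dif_homog:
  "x \<in> homog i \<Longrightarrow> koszul_dif x y = dif x \<otimes> y + (-1) ^ i *\<^sub>C (x \<otimes> dif y)"
  by (simp add: koszul_dif_def graded_ext_homog clinear_0[OF clinear_tensor_left[OF clinear_ident]])

lemma koszul_signs:
  fixes A B C D :: "'a::complex_vector"
  shows "(-1) ^ (i * j) *\<^sub>C ((A + (-1) ^ a *\<^sub>C B) + (-1) ^ (a + j) *\<^sub>C (C + (-1) ^ i *\<^sub>C D)) =
    ((-1) ^ (i * j) *\<^sub>C A + (-1) ^ a *\<^sub>C (-1) ^ (Suc i * j) *\<^sub>C C) +
    (-1) ^ (a + i) *\<^sub>C ((-1) ^ (i * Suc j) *\<^sub>C B + (-1) ^ j *\<^sub>C (-1) ^ (i * j) *\<^sub>C D)"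
  by (cases "even a"; cases "even i"; cases "even j") (simp_all add: minus_one_power_iff)

lemma star_signs:
  "(-1) ^ (j * k) *\<^sub>C (-1) ^ (j * l) *\<^sub>C (-1) ^ (i * k) *\<^sub>C A =
    (-1) ^ ((i + j) * (k + l)) *\<^sub>C (-1) ^ (l * i) *\<^sub>C (A :: 'a::complex_vector)"
  by (cases "even i"; cases "even j"; cases "even k"; cases "even l") (simp_all add: minus_one_power_iff)

instantiation tensor :: (graded_diff_star_algebra, graded_diff_star_algebra) graded_diff_star_algebra
begin

definition times_tensor :: "('a, 'b) tensor \<Rightarrow> ('a, 'b) tensor \<Rightarrow> ('a, 'b) tensor"
  where "s * t = tlift (\<lambda>x y. tlift (koszul_mult x y) t) s"

definition one_tensor :: "('a, 'b) tensor"
  where "1 = 1 \<otimes> 1"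

definition dif_tensor :: "('a, 'b) tensor \<Rightarrow> ('a, 'b) tensor"
  where "dif = tlift koszul_dif"

definition star_tensor :: "('a, 'b) tensor \<Rightarrow> ('a, 'b) tensor"
  where "star = conj_tlift (\<lambda>x y. star x \<otimes> star y)"

definition homog_tensor :: "nat \<Rightarrow> ('a, 'b) tensor set"
  where "homog n = cspan {x \<otimes> y | x y. \<exists>i j. x \<in> homog i \<and> y \<in> homog j \<and> i + j = n}"

context
begin

private lemma pure_mult:
  "((x :: 'a) \<otimes> (y :: 'b)) * (x' \<otimes> y') = koszul_mult x y x' y'"
  unfolding times_tensor_def
  by (subst tlift_pure[OF cbilinear_mult_outer]) (rule tlift_pure[OF cbilinear_koszul_mult])

private lemma mult_homog:
  "(y :: 'b) \<in> homog i \<Longrightarrow> x' \<in> homog j \<Longrightarrow>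
    ((x :: 'a) \<otimes> y) * (x' \<otimes> y') = (-1) ^ (i * j) *\<^sub>C ((x * x') \<otimes> (y * y'))"
  by (simp add: pure_mult koszul_mult_homog)

private lemma lin_left: "clinear (\<lambda>s. s * (t :: ('a, 'b) tensor))"
  unfolding times_tensor_def by (rule clinear_tlift[OF cbilinear_mult_outer])

private lemma lin_right: "clinear (\<lambda>t. s * (t :: ('a, 'b) tensor))"
proof -
  have "clinear (\<lambda>t. tlift (\<lambda>x y. tlift (koszul_mult x y) t) s)"
    by (rule clinearI)
      (simp_all add: clinear_add[OF clinear_tlift[OF cbilinear_koszul_mult]]
        clinear_scale[OF clinear_tlift[OF cbilinear_koszul_mult]] tlift_plus_fun tlift_scale_fun)
  then show ?thesis unfolding times_tensor_def .
qed

private lemma lin_dif: "clinear (dif :: ('a, 'b) tensor \<Rightarrow> _)"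
  unfolding dif_tensor_def by (rule clinear_tlift[OF cbilinear_koszul_dif])

private lemma pure_dif:
  "(x :: 'a) \<in> homog i \<Longrightarrow> dif (x \<otimes> (y :: 'b)) = dif x \<otimes> y + (-1) ^ i *\<^sub>C (x \<otimes> dif y)"
  by (simp add: dif_tensor_def cbilinear_koszul_dif koszul_dif_homog)

private lemma pure_star: "star ((x :: 'a) \<otimes> (y :: 'b)) = star x \<otimes> star y"
  by (simp add: star_tensor_def conj_bilinear_star_tensor)

private lemma st_add: "star (s + t) = star s + star (t :: ('a, 'b) tensor)"
  and st_scale: "star (c *\<^sub>C t) = cnj c *\<^sub>C star (t :: ('a, 'b) tensor)"
  by (simp_all add: star_tensor_def conj_bilinear_star_tensor conj_tlift_add conj_tlift_scale)

private lemma pure_homog: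
  "(x :: 'a) \<in> homog i \<Longrightarrow> (y :: 'b) \<in> homog j \<Longrightarrow> x \<otimes> y \<in> homog (i + j)"
  unfolding homog_tensor_def by (rule cvec.span_base) blast

private lemma sub: "csubspace (homog n :: ('a, 'b) tensor set)"
  unfolding homog_tensor_def by (rule cvec.subspace_span)

private lemma homog_induct:
  assumes "(t :: ('a, 'b) tensor) \<in> homog n" "P 0"
    and "\<And>c x y i j t. (x :: 'a) \<in> homog i \<Longrightarrow> (y :: 'b) \<in> homog j \<Longrightarrow> i + j = n \<Longrightarrow> P t \<Longrightarrow> P (c *\<^sub>C (x \<otimes> y) + t)"
  shows "P t"
  using assms(1) unfolding homog_tensor_def
  by (induction rule: cvec.span_induct_alt) (use assms(2,3) in blast)+

private definition proj :: "nat \<Rightarrow> ('a, 'b) tensor \<Rightarrow> ('a, 'b) tensor"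
  where "proj n = tlift (\<lambda>x y. graded_ext (\<lambda>i u. graded_ext (\<lambda>j v. if i + j = n then u \<otimes> v else 0) y) x)"

private lemma cbil_proj:
  "cbilinear (\<lambda>x y. graded_ext (\<lambda>i u. graded_ext (\<lambda>j v. if i + j = n then u \<otimes> v else 0) (y :: 'b)) (x :: 'a))"
proof -
  have z: "clinear (\<lambda>_. 0)" by (simp add: clinear_iff)
  have 1: "clinear (\<lambda>v. if i + j = n then (u :: 'a) \<otimes> (v :: 'b) else 0)" for i j u
    by (cases "i + j = n") (simp_all add: z clinear_tensor_right clinear_ident)
  have 2: "clinear (\<lambda>u. if i + j = n then (u :: 'a) \<otimes> (v :: 'b) else 0)" for i j v
    by (cases "i + j = n") (simp_all add: z clinear_tensor_left clinear_ident)
  show ?thesis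
  proof (rule cbilinearI)
    show "clinear (\<lambda>y. graded_ext (\<lambda>i u. graded_ext (\<lambda>j v. if i + j = n then u \<otimes> v else 0) (y :: 'b)) x)"
      for x :: 'a
      unfolding graded_ext_def[where x = x] by (intro clinear_sum_fun clinear_graded_ext 1)
    show "clinear (\<lambda>x. graded_ext (\<lambda>i u. graded_ext (\<lambda>j v. if i + j = n then u \<otimes> v else 0) y) (x :: 'a))"
      for y :: 'b
      by (intro clinear_graded_ext) (unfold graded_ext_def, intro clinear_sum_fun 2)
  qed
qed

private lemma lin_proj: "clinear (proj n)"
  unfolding proj_def by (rule clinear_tlift[OF cbil_proj])

private lemma proj_pure:
  assumes "x \<in> homog i" "y \<in> homog j"
  shows "proj n (x \<otimes> y) = (if i + j = n then x \<otimes> y else 0)"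
proof -
  have "(\<lambda>u. 0 \<otimes> u) = (\<lambda>u::'b. 0 :: ('a, 'b) tensor)" "(\<lambda>u. u \<otimes> 0) = (\<lambda>u::'a. 0 :: ('a, 'b) tensor)"
    by (auto simp: clinear_0[OF clinear_tensor_left[OF clinear_ident]]
        clinear_0[OF clinear_tensor_right[OF clinear_ident]])
  then have 0: "0 \<otimes> u = (0 :: ('a, 'b) tensor)" "v \<otimes> 0 = (0 :: ('a, 'b) tensor)" for u v
    by meson+
  have "proj n (x \<otimes> y) = graded_ext (\<lambda>i u. graded_ext (\<lambda>j v. if i + j = n then u \<otimes> v else 0) y) x"
    unfolding proj_def by (rule tlift_pure[OF cbil_proj])
  also have "\<dots> = graded_ext (\<lambda>j v. if i + j = n then x \<otimes> v else 0) y"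
    by (rule graded_ext_homog[OF assms(1)]) (simp add: 0 graded_ext_def cong: if_cong)
  also have "\<dots> = (if i + j = n then x \<otimes> y else 0)"
    by (rule graded_ext_homog[OF assms(2)]) (simp add: 0)
  finally show ?thesis .
qed

private lemma proj_homog:
  assumes "t \<in> homog m"
  shows "proj n t = (if m = n then t else 0)"
  using assms
proof (rule homog_induct)
  show "proj n 0 = (if m = n then 0 else 0)" by (simp add: clinear_0[OF lin_proj])
qed (auto simp: clinear_add[OF lin_proj] clinear_scale[OF lin_proj] proj_pure)

private lemma decomp_ex:
  "\<exists>c. (\<forall>n. Poly_Mapping.lookup c n \<in> homog n) \<and>
     (t :: ('a, 'b) tensor) = (\<Sum>n\<in>Poly_Mapping.keys c. Poly_Mapping.lookup c n)"
  using cspan_homog_tensor[of t]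
proof (induction rule: cvec.span_induct_alt)
  case base
  show ?case by (rule exI[of _ 0]) (simp add: cvec.subspace_0 sub)
next
  case (step c s t)
  then obtain a where a: "\<forall>n. Poly_Mapping.lookup a n \<in> homog n"
    "t = (\<Sum>n\<in>Poly_Mapping.keys a. Poly_Mapping.lookup a n)" by blast
  from step obtain x y i j where s: "s = x \<otimes> y" "x \<in> homog i" "y \<in> homog j" by blast
  let ?b = "Poly_Mapping.single (i + j) (c *\<^sub>C s)"
  let ?A = "insert (i + j) (Poly_Mapping.keys a)"
  have "c *\<^sub>C s \<in> homog (i + j)" using s by (simp add: pure_homog cvec.subspace_scale sub)
  then have "\<forall>n. Poly_Mapping.lookup (?b + a) n \<in> homog n"
    using a by (auto simp: lookup_add lookup_single when_def intro: cvec.subspace_add sub cvec.subspace_0)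
  moreover have "(\<Sum>n\<in>Poly_Mapping.keys (?b + a). Poly_Mapping.lookup (?b + a) n) = c *\<^sub>C s + t"
  proof -
    have k: "Poly_Mapping.keys (?b + a) \<subseteq> ?A"
      using Poly_Mapping.keys_add[of ?b a] by (auto split: if_splits)
    have "(\<Sum>n\<in>Poly_Mapping.keys (?b + a). Poly_Mapping.lookup (?b + a) n) = (\<Sum>n\<in>?A. Poly_Mapping.lookup (?b + a) n)"
      by (rule sum_lookup_superset[where L = "\<lambda>_ x. x", OF _ k]) auto
    also have "\<dots> = (\<Sum>n\<in>?A. Poly_Mapping.lookup ?b n) + (\<Sum>n\<in>?A. Poly_Mapping.lookup a n)"
      by (simp only: lookup_add sum.distrib)
    also have "(\<Sum>n\<in>?A. Poly_Mapping.lookup ?b n) = (\<Sum>n\<in>?A. if n = i + j then c *\<^sub>C s else 0)"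
      by (rule sum.cong) (auto simp: lookup_single when_def)
    also have "\<dots> = c *\<^sub>C s"
      by (subst sum.delta) auto
    also have "(\<Sum>n\<in>?A. Poly_Mapping.lookup a n) = t"
      unfolding a(2) by (rule sum_lookup_superset[where L = "\<lambda>_ x. x", symmetric]) auto
    finally show ?thesis .
  qed
  ultimately show ?case by (intro exI[of _ "?b + a"]) simp
qed

instance
proof
  fix s t u :: "('a, 'b) tensor" and c :: complex and m n :: nat
  show "s * t * u = s * (t * u)"
  proof -
    have A: "(x \<otimes> y) * (x' \<otimes> y') * (x'' \<otimes> y'') = (x \<otimes> y) * ((x' \<otimes> y') * (x'' \<otimes> y''))"
      if "x \<in> homog h" "y \<in> homog i" "x' \<in> homog j" "y' \<in> homog k" "x'' \<in> homog l" "y'' \<in> homog m"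
      for x x' x'' :: 'a and y y' y'' :: 'b and h i j k l m
      using that
      by (simp add: mult_homog[of y i x' j] mult_homog[of y' k x'' l] homog_mult mult.assoc
          clinear_scale[OF lin_left] clinear_scale[OF lin_right]
          mult_homog[of "y * y'" "i + k" x'' l] mult_homog[of y i "x' * x''" "j + l"]
          distrib_left distrib_right power_add mult.commute mult.left_commute)
    have B: "(x \<otimes> y) * (x' \<otimes> y') * u = (x \<otimes> y) * ((x' \<otimes> y') * u)"
      if "x \<in> homog h" "y \<in> homog i" "x' \<in> homog j" "y' \<in> homog k"
      for x x' :: 'a and y y' :: 'b and h i j k
      by (rule tensor_homog_eqI) (use A that in \<open>auto intro!: lin_right clinear_compose[OF lin_right]\<close>)
    have C: "(x \<otimes> y) * t * u = (x \<otimes> y) * (t * u)"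
      if "x \<in> homog h" "y \<in> homog i" for x :: 'a and y :: 'b and h i
      by (rule tensor_homog_eqI[of "\<lambda>t. (x \<otimes> y) * t * u" "\<lambda>t. (x \<otimes> y) * (t * u)"])
        (use B that in \<open>auto intro!: clinear_compose[OF lin_left lin_right] clinear_compose[OF lin_right lin_left]\<close>)
    show ?thesis
      by (rule tensor_homog_eqI[of "\<lambda>s. s * t * u" "\<lambda>s. s * (t * u)"])
        (use C in \<open>auto intro!: lin_left clinear_compose[OF lin_left lin_left]\<close>)
  qed
  show "(s + t) * u = s * u + t * u" by (rule clinear_add[OF lin_left])
  show "s * (t + u) = s * t + s * u" by (rule clinear_add[OF lin_right])
  show "c *\<^sub>C s * t = c *\<^sub>C (s * t)" by (rule clinear_scale[OF lin_left])
  show "s * c *\<^sub>C t = c *\<^sub>C (s * t)" by (rule clinear_scale[OF lin_right])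
  show "1 * t = t"
    by (rule tensor_homog_eqI[of "\<lambda>t. 1 * t"])
      (auto simp: lin_right clinear_ident one_tensor_def mult_homog[OF homog_one])
  show "t * 1 = t"
    by (rule tensor_homog_eqI[of "\<lambda>t. t * 1"])
      (auto simp: lin_left clinear_ident one_tensor_def mult_homog[OF _ homog_one])
  show "0 \<in> (homog n :: ('a, 'b) tensor set)"
    "s \<in> homog n \<Longrightarrow> t \<in> homog n \<Longrightarrow> s + t \<in> homog n"
    "s \<in> homog n \<Longrightarrow> c *\<^sub>C s \<in> homog n"
    by (simp_all add: cvec.subspace_0 cvec.subspace_add cvec.subspace_scale sub)
  show "\<exists>!c. (\<forall>n. c n \<in> homog n) \<and> finite {n. c n \<noteq> 0} \<and> t = (\<Sum>n | c n \<noteq> 0. c n)"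
  proof (rule ex_ex1I)
    obtain c where "\<forall>n. Poly_Mapping.lookup c n \<in> homog n"
      "t = (\<Sum>n\<in>Poly_Mapping.keys c. Poly_Mapping.lookup c n)" using decomp_ex[of t] by blast
    then show "\<exists>c. (\<forall>n. c n \<in> homog n) \<and> finite {n. c n \<noteq> 0} \<and> t = (\<Sum>n | c n \<noteq> 0. c n)"
      by (intro exI[of _ "Poly_Mapping.lookup c"]) (simp add: keys.rep_eq)
  next
    have *: "c = (\<lambda>n. proj n t)"
      if c: "\<forall>n. c n \<in> homog n" "finite {n. c n \<noteq> 0}" "t = (\<Sum>n | c n \<noteq> 0. c n)" for c
    proof
      fix n
      have "proj n t = (\<Sum>k | c k \<noteq> 0. proj n (c k))"
        by (subst c(3)) (rule clinear_sum[OF lin_proj])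
      also have "\<dots> = (\<Sum>k | c k \<noteq> 0. if k = n then c k else 0)"
        using c(1) by (intro sum.cong refl proj_homog) simp
      also have "\<dots> = c n" using c(2) by (simp add: sum.delta)
      finally show "c n = proj n t" ..
    qed
    show "c = c'" if "(\<forall>n. c n \<in> homog n) \<and> finite {n. c n \<noteq> 0} \<and> t = (\<Sum>n | c n \<noteq> 0. c n)"
      "(\<forall>n. c' n \<in> homog n) \<and> finite {n. c' n \<noteq> 0} \<and> t = (\<Sum>n | c' n \<noteq> 0. c' n)" for c c'
      using *[of c] *[of c'] that by simp
  qed
  show "1 \<in> (homog 0 :: ('a, 'b) tensor set)"
    using pure_homog[OF homog_one homog_one] by (simp add: one_tensor_def)
  show "s * t \<in> homog (m + n)" if "s \<in> homog m" "t \<in> homog n"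
    using that(1)
  proof (rule homog_induct)
    show "0 * t \<in> homog (m + n)" by (simp add: clinear_0[OF lin_left] cvec.subspace_0 sub)
  next
    fix c and x :: 'a and y :: 'b and i j and s :: "('a, 'b) tensor"
    assume *: "x \<in> homog i" "y \<in> homog j" "i + j = m" "s * t \<in> homog (m + n)"
    have "(x \<otimes> y) * t \<in> homog (m + n)"
      using that(2)
    proof (rule homog_induct)
      show "(x \<otimes> y) * 0 \<in> homog (m + n)" by (simp add: clinear_0[OF lin_right] cvec.subspace_0 sub)
    next
      fix c and x' :: 'a and y' :: 'b and k l and t :: "('a, 'b) tensor"
      assume **: "x' \<in> homog k" "y' \<in> homog l" "k + l = n" "(x \<otimes> y) * t \<in> homog (m + n)"
      have "(x * x') \<otimes> (y * y') \<in> homog ((i + k) + (j + l))"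
        using * ** by (intro pure_homog homog_mult)
      then have "(x * x') \<otimes> (y * y') \<in> homog (m + n)"
        using *(3) **(3) by (metis add.assoc add.left_commute)
      then show "(x \<otimes> y) * (c *\<^sub>C (x' \<otimes> y') + t) \<in> homog (m + n)"
        using * ** by (simp add: clinear_add[OF lin_right] clinear_scale[OF lin_right]
            mult_homog[of y j x' k] cvec.subspace_add cvec.subspace_scale sub)
    qed
    then show "(c *\<^sub>C (x \<otimes> y) + s) * t \<in> homog (m + n)"
      using * by (simp add: clinear_add[OF lin_left] clinear_scale[OF lin_left]
          cvec.subspace_add cvec.subspace_scale sub)
  qed
  show "dif (s + t) = dif s + dif t" by (rule clinear_add[OF lin_dif])
  show "dif (c *\<^sub>C s) = c *\<^sub>C dif s" by (rule clinear_scale[OF lin_dif])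
  show "dif s \<in> homog (Suc n)" if "s \<in> homog n"
    using that
  proof (rule homog_induct)
    show "dif 0 \<in> (homog (Suc n) :: ('a, 'b) tensor set)"
      by (simp add: clinear_0[OF lin_dif] cvec.subspace_0 sub)
  next
    fix c and x :: 'a and y :: 'b and i j and s :: "('a, 'b) tensor"
    assume *: "x \<in> homog i" "y \<in> homog j" "i + j = n" "dif s \<in> homog (Suc n)"
    have "dif x \<otimes> y \<in> homog (Suc n)" "x \<otimes> dif y \<in> homog (Suc n)"
      using pure_homog[OF dif_homog[OF *(1)] *(2)] pure_homog[OF *(1) dif_homog[OF *(2)]] *(3) by auto
    then show "dif (c *\<^sub>C (x \<otimes> y) + s) \<in> homog (Suc n)"
      using * by (simp add: clinear_add[OF lin_dif] clinear_scale[OF lin_dif] pure_dif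
          cvec.subspace_add cvec.subspace_scale sub)
  qed
  show "dif (dif t) = 0"
  proof (rule tensor_homog_eqI[of "\<lambda>t. dif (dif t)" "\<lambda>_. 0"])
    fix x :: 'a and y :: 'b and i j
    assume "x \<in> homog i" "y \<in> homog j"
    then show "dif (dif (x \<otimes> y)) = 0"
      by (simp add: pure_dif[of x i] pure_dif[OF dif_homog[of x i]] clinear_add[OF lin_dif]
          clinear_scale[OF lin_dif] dif_dif clinear_0[OF clinear_tensor_left[OF clinear_ident]]
          clinear_0[OF clinear_tensor_right[OF clinear_ident]])
  qed (auto intro!: clinear_compose[OF lin_dif lin_dif] simp: clinear_iff[of "\<lambda>_. 0"])
  show "dif (s * t) = dif s * t + (- 1) ^ n *\<^sub>C (s * dif t)" if "s \<in> homog n"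
    using that
  proof (rule homog_induct)
    show "dif (0 * t) = dif 0 * t + (- 1) ^ n *\<^sub>C (0 * dif t)"
      by (simp add: clinear_0[OF lin_dif] clinear_0[OF lin_left])
  next
    fix c and x :: 'a and y :: 'b and a i and s :: "('a, 'b) tensor"
    assume *: "x \<in> homog a" "y \<in> homog i" "a + i = n"
      "dif (s * t) = dif s * t + (- 1) ^ n *\<^sub>C (s * dif t)"
    have "dif ((x \<otimes> y) * t) = dif (x \<otimes> y) * t + (- 1) ^ n *\<^sub>C ((x \<otimes> y) * dif t)"
    proof (rule tensor_homog_eqI[of "\<lambda>t. dif ((x \<otimes> y) * t)"
          "\<lambda>t. dif (x \<otimes> y) * t + (- 1) ^ n *\<^sub>C ((x \<otimes> y) * dif t)"])
      fix x' :: 'a and y' :: 'b and j k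
      assume **: "x' \<in> homog j" "y' \<in> homog k"
      show "dif ((x \<otimes> y) * (x' \<otimes> y')) =
          dif (x \<otimes> y) * (x' \<otimes> y') + (- 1) ^ n *\<^sub>C ((x \<otimes> y) * dif (x' \<otimes> y'))"
      proof -
        have n: "n = a + i" using *(3) by simp
        have "dif ((x \<otimes> y) * (x' \<otimes> y')) =
          (-1) ^ (i * j) *\<^sub>C ((((dif x * x') \<otimes> (y * y')) + (-1) ^ a *\<^sub>C ((x * dif x') \<otimes> (y * y')))
            + (-1) ^ (a + j) *\<^sub>C (((x * x') \<otimes> (dif y * y')) + (-1) ^ i *\<^sub>C ((x * x') \<otimes> (y * dif y'))))"
          unfolding mult_homog[OF *(2) **(1)] clinear_scale[OF lin_dif]
            pure_dif[OF homog_mult[OF *(1) **(1)]] dif_mult[OF *(1)] dif_mult[OF *(2)]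
            tensor_add_left tensor_add_right tensor_scale_left tensor_scale_right ..
        also have "\<dots> = ((-1) ^ (i * j) *\<^sub>C ((dif x * x') \<otimes> (y * y')) +
            (-1) ^ a *\<^sub>C (-1) ^ (Suc i * j) *\<^sub>C ((x * x') \<otimes> (dif y * y'))) +
            (-1) ^ n *\<^sub>C ((-1) ^ (i * Suc j) *\<^sub>C ((x * dif x') \<otimes> (y * y')) +
              (-1) ^ j *\<^sub>C (-1) ^ (i * j) *\<^sub>C ((x * x') \<otimes> (y * dif y')))"
          unfolding n by (rule koszul_signs)
        also have "\<dots> = dif (x \<otimes> y) * (x' \<otimes> y') + (- 1) ^ n *\<^sub>C ((x \<otimes> y) * dif (x' \<otimes> y'))"
          unfolding pure_dif[OF *(1)] pure_dif[OF **(1)] clinear_add[OF lin_left]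
            clinear_scale[OF lin_left] clinear_add[OF lin_right] clinear_scale[OF lin_right]
            mult_homog[OF *(2) **(1)] mult_homog[OF dif_homog[OF *(2)] **(1)]
            mult_homog[OF *(2) dif_homog[OF **(1)]] ..
        finally show ?thesis .
      qed
    qed (auto intro!: clinear_compose[OF lin_dif lin_right] clinear_plus clinear_scaled lin_right
        clinear_compose[OF lin_right lin_dif])
    then show "dif ((c *\<^sub>C (x \<otimes> y) + s) * t) =
        dif (c *\<^sub>C (x \<otimes> y) + s) * t + (- 1) ^ n *\<^sub>C ((c *\<^sub>C (x \<otimes> y) + s) * dif t)"
      using *(4) by (simp add: clinear_add[OF lin_dif] clinear_scale[OF lin_dif]
          clinear_add[OF lin_left] clinear_scale[OF lin_left] cvec.scale_right_distrib
          cvec.scale_left_commute[of "(-1) ^ n"] del: cvec.scale_scale)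
  qed
  show "star (s + t) = star s + star t" by (rule st_add)
  show "star (c *\<^sub>C s) = cnj c *\<^sub>C star s" by (rule st_scale)
  show "star (star t) = t"
    by (rule tensor_homog_eqI[of "\<lambda>t. star (star t)" "\<lambda>t. t"])
      (auto simp: clinear_iff st_add st_scale pure_star star_star)
  have star0: "star 0 = (0 :: ('a, 'b) tensor)"
    by (metis complex_cnj_zero cvec.scale_zero_left st_scale)
  show "star s \<in> homog n" if "s \<in> homog n"
    using that
    by (rule homog_induct)
      (auto simp: star0 st_add st_scale pure_star intro!: cvec.subspace_0 cvec.subspace_add
        cvec.subspace_scale sub pure_homog star_homog)
  show "star (s * t) = (- 1) ^ (m * n) *\<^sub>C (star t * star s)" if "s \<in> homog m" "t \<in> homog n"
    using that(1)
  proof (rule homog_induct)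
    show "star (0 * t) = (- 1) ^ (m * n) *\<^sub>C (star t * star 0)"
      by (simp add: star0 clinear_0[OF lin_left] clinear_0[OF lin_right])
  next
    fix c and x :: 'a and y :: 'b and i j and s :: "('a, 'b) tensor"
    assume *: "x \<in> homog i" "y \<in> homog j" "i + j = m" "star (s * t) = (- 1) ^ (m * n) *\<^sub>C (star t * star s)"
    have "star ((x \<otimes> y) * t) = (- 1) ^ (m * n) *\<^sub>C (star t * star (x \<otimes> y))"
      using that(2)
    proof (rule homog_induct)
      show "star ((x \<otimes> y) * 0) = (- 1) ^ (m * n) *\<^sub>C (star 0 * star (x \<otimes> y))"
        by (simp add: star0 clinear_0[OF lin_left] clinear_0[OF lin_right])
    next
      fix c and x' :: 'a and y' :: 'b and k l and t :: "('a, 'b) tensor"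
      assume **: "x' \<in> homog k" "y' \<in> homog l" "k + l = n"
        "star ((x \<otimes> y) * t) = (- 1) ^ (m * n) *\<^sub>C (star t * star (x \<otimes> y))"
      have "star ((x \<otimes> y) * (x' \<otimes> y')) = (- 1) ^ (m * n) *\<^sub>C (star (x' \<otimes> y') * star (x \<otimes> y))"
      proof -
        have sgn: "cnj ((-1) ^ p) = (-1) ^ p" for p by simp
        have "star ((x \<otimes> y) * (x' \<otimes> y')) = (-1) ^ (j * k) *\<^sub>C (-1) ^ (j * l) *\<^sub>C (-1) ^ (i * k) *\<^sub>C
            ((star x' * star x) \<otimes> (star y' * star y))"
          unfolding mult_homog[OF *(2) **(1)] st_scale pure_star star_mult[OF *(1) **(1)]
            star_mult[OF *(2) **(2)] tensor_scale_left tensor_scale_right sgn ..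
        also have "\<dots> = (- 1) ^ (m * n) *\<^sub>C (-1) ^ (l * i) *\<^sub>C ((star x' * star x) \<otimes> (star y' * star y))"
          unfolding *(3)[symmetric] **(3)[symmetric] by (rule star_signs)
        also have "\<dots> = (- 1) ^ (m * n) *\<^sub>C (star (x' \<otimes> y') * star (x \<otimes> y))"
          unfolding pure_star mult_homog[OF star_homog[OF **(2)] star_homog[OF *(1)]] ..
        finally show ?thesis .
      qed
      then show "star ((x \<otimes> y) * (c *\<^sub>C (x' \<otimes> y') + t)) =
          (- 1) ^ (m * n) *\<^sub>C (star (c *\<^sub>C (x' \<otimes> y') + t) * star (x \<otimes> y))"
        using **(4) by (simp add: clinear_add[OF lin_right] clinear_scale[OF lin_right] st_add st_scale
            clinear_add[OF lin_left] clinear_scale[OF lin_left] cvec.scale_right_distrib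
            cvec.scale_left_commute[of "(-1) ^ _"] del: cvec.scale_scale)
    qed
    then show "star ((c *\<^sub>C (x \<otimes> y) + s) * t) =
        (- 1) ^ (m * n) *\<^sub>C (star t * star (c *\<^sub>C (x \<otimes> y) + s))"
      using *(4) by (simp add: clinear_add[OF lin_right] clinear_scale[OF lin_right] st_add st_scale
          clinear_add[OF lin_left] clinear_scale[OF lin_left] cvec.scale_right_distrib
          cvec.scale_left_commute[of "(-1) ^ _"] del: cvec.scale_scale)
  qed
  show "dif (star t) = star (dif t)"
    using cspan_homog_tensor[of t]
  proof (induction rule: cvec.span_induct_alt)
    case base
    show ?case by (simp add: star0 clinear_0[OF lin_dif])
  next
    case (step c u t)
    then obtain x y i j where "u = x \<otimes> y" "x \<in> homog i" "y \<in> homog j" by blast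
    then have "dif (star u) = star (dif u)"
      by (simp add: pure_star pure_dif[of x i] pure_dif[of "star x" i] star_homog dif_star st_add st_scale)
    then show ?case
      using step by (simp add: st_add st_scale clinear_add[OF lin_dif] clinear_scale[OF lin_dif])
  qed
qed

end

end

lemma tensor_mult_homog:
  "y \<in> homog i \<Longrightarrow> x' \<in> homog j \<Longrightarrow>
    (x \<otimes> y) * (x' \<otimes> y') = (-1) ^ (i * j) *\<^sub>C ((x * x') \<otimes> (y * y'))"
  unfolding times_tensor_def
  by (subst tlift_pure[OF cbilinear_mult_outer], subst tlift_pure[OF cbilinear_koszul_mult])
    (rule koszul_mult_homog)

lemma tensor_dif_homog:
  "x \<in> homog i \<Longrightarrow> dif (x \<otimes> y) = dif x \<otimes> y + (-1) ^ i *\<^sub>C (x \<otimes> dif y)"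
  by (simp add: dif_tensor_def cbilinear_koszul_dif koszul_dif_homog)

lemma tensor_star_pure: "star (x \<otimes> y) = star x \<otimes> star y"
  by (simp add: star_tensor_def conj_bilinear_star_tensor)

text \<open>The multiplication map on the tensor square.\<close>

definition tmult :: "('a::complex_algebra, 'a) tensor \<Rightarrow> 'a"
  where "tmult = tlift (*)"

definition graded_diff_algebra_hom ::
    "('a::graded_diff_star_algebra \<Rightarrow> 'b::graded_diff_star_algebra) \<Rightarrow> bool"
  where "graded_diff_algebra_hom f \<longleftrightarrow> clinear f \<and> f 1 = 1 \<and> (\<forall>x y. f (x * y) = f x * f y) \<and>
     (\<forall>n. f ` homog n \<subseteq> homog n) \<and> (\<forall>x. f (dif x) = dif (f x))"

definition graded_diff_star_algebra_hom ::
    "('a::graded_diff_star_algebra \<Rightarrow> 'b::graded_diff_star_algebra) \<Rightarrow> bool"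
  where "graded_diff_star_algebra_hom f \<longleftrightarrow>
     graded_diff_algebra_hom f \<and> (\<forall>x. f (star x) = star (f x))"

definition star_subalgebra :: "'a::graded_diff_star_algebra set \<Rightarrow> bool"
  where "star_subalgebra A \<longleftrightarrow> csubspace A \<and> 1 \<in> A \<and> (\<forall>x\<in>A. \<forall>y\<in>A. x * y \<in> A) \<and> (\<forall>x\<in>A. star x \<in> A)"

inductive_set generated_algebra :: "'a::complex_algebra set \<Rightarrow> 'a set" for X where
  base: "x \<in> X \<Longrightarrow> x \<in> generated_algebra X"
| one: "1 \<in> generated_algebra X"
| add: "x \<in> generated_algebra X \<Longrightarrow> y \<in> generated_algebra X \<Longrightarrow> x + y \<in> generated_algebra X"
| scale: "x \<in> generated_algebra X \<Longrightarrow> c *\<^sub>C x \<in> generated_algebra X"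
| mult: "x \<in> generated_algebra X \<Longrightarrow> y \<in> generated_algebra X \<Longrightarrow> x * y \<in> generated_algebra X"

inductive_set generated_diff_star_algebra ::
    "'a::graded_diff_star_algebra set \<Rightarrow> 'a set" for X where
  base: "x \<in> X \<Longrightarrow> x \<in> generated_diff_star_algebra X"
| one: "1 \<in> generated_diff_star_algebra X"
| add: "x \<in> generated_diff_star_algebra X \<Longrightarrow> y \<in> generated_diff_star_algebra X \<Longrightarrow>
    x + y \<in> generated_diff_star_algebra X"
| scale: "x \<in> generated_diff_star_algebra X \<Longrightarrow> c *\<^sub>C x \<in> generated_diff_star_algebra X"
| mult: "x \<in> generated_diff_star_algebra X \<Longrightarrow> y \<in> generated_diff_star_algebra X \<Longrightarrow>
    x * y \<in> generated_diff_star_algebra X"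
| dif: "x \<in> generated_diff_star_algebra X \<Longrightarrow> dif x \<in> generated_diff_star_algebra X"
| star: "x \<in> generated_diff_star_algebra X \<Longrightarrow> star x \<in> generated_diff_star_algebra X"

text \<open>A linear map defined on a subspace is represented throughout by a linear map on the whole
  type, of which only the restriction to the subspace is ever constrained or used.\<close>

section \<open>Quantum groups and their differential calculi\<close>

text \<open>
  The type \<open>'w\<close> carries the envelope \<open>\<Gamma>\<^sup>\<and>\<close>.  Its degree-zero part \<open>homog 0\<close> is the Hopf algebra \<open>H\<close>
  and its degree-one part \<open>homog 1\<close> is the bimodule \<open>\<Gamma>\<close> of the first-order calculus, with
  differential \<open>dif\<close>.  Since all maps preserve degrees, the structure of \<open>H\<close> is the
  restriction of that of \<open>\<Gamma>\<^sup>\<and>\<close>.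
\<close>

locale graded_diff_star_hopf_algebra =
  fixes comult :: "'w::graded_diff_star_algebra \<Rightarrow> ('w, 'w) tensor"
    and counit :: "'w \<Rightarrow> complex"
    and antipode :: "'w \<Rightarrow> 'w"
  assumes comult_hom: "graded_diff_star_algebra_hom comult"
    and coassoc: "tassoc (tmap comult id (comult w)) = tmap id comult (comult w)"
    and counit_linear: "clinear counit"
    and counit_one: "counit 1 = 1"
    and counit_mult: "counit (v * w) = counit v * counit w"
    and counit_star: "counit (star w) = cnj (counit w)"
    and counit_homog: "w \<in> homog n \<Longrightarrow> n > 0 \<Longrightarrow> counit w = 0"
    and counit_left: "tlift (\<lambda>u v. counit u *\<^sub>C v) (comult w) = w"
    and counit_right: "tlift (\<lambda>u v. counit v *\<^sub>C u) (comult w) = w"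
    and antipode_linear: "clinear antipode"
    and antipode_homog: "w \<in> homog n \<Longrightarrow> antipode w \<in> homog n"
    and antipode_left: "tmult (tmap antipode id (comult w)) = counit w *\<^sub>C 1"
    and antipode_right: "tmult (tmap id antipode (comult w)) = counit w *\<^sub>C 1"

text \<open>The dense Hopf star-algebra of a compact matrix quantum group: it is generated, as an algebra,
  by the entries of a finite-dimensional unitary corepresentation.  (Starting from a fundamental
  corepresentation \<open>v\<close> in the sense of Woronowicz, such a corepresentation is obtained by unitarising
  the direct sum of \<open>v\<close> and its conjugate.)\<close>

locale compact_matrix_quantum_group = graded_diff_star_hopf_algebra comult counit antipode
  for comult :: "'w::graded_diff_star_algebra \<Rightarrow> ('w, 'w) tensor" and counit antipode +
  assumes fundamental_corepresentation:
    "\<exists>(n :: nat) u.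
       (\<forall>i<n. \<forall>j<n. u i j \<in> homog 0 \<and> comult (u i j) = (\<Sum>k<n. u i k \<otimes> u k j) \<and>
          (\<Sum>k<n. star (u k i) * u k j) = (if i = j then 1 else 0) \<and>
          (\<Sum>k<n. u i k * star (u j k)) = (if i = j then 1 else 0)) \<and>
       generated_algebra {u i j | i j. i < n \<and> j < n} = homog 0"

text \<open>\<open>coactL\<close> and \<open>coactR\<close> are the left and right coactions of \<open>H\<close> on \<open>\<Gamma>\<close>.\<close>

locale bicovariant_star_calculus = compact_matrix_quantum_group comult counit antipode
  for comult :: "'w::graded_diff_star_algebra \<Rightarrow> ('w, 'w) tensor" and counit antipode +
  fixes coactL coactR :: "'w \<Rightarrow> ('w, 'w) tensor"
  assumes forms_generated: "homog 1 = cspan {g * dif h | (g :: 'w) h. g \<in> homog 0 \<and> h \<in> homog 0}"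
    and coactL_linear: "clinear coactL"
    and coactR_linear: "clinear coactR"
    and coactL: "g \<in> homog 0 \<Longrightarrow> h \<in> homog 0 \<Longrightarrow> coactL (g * dif h) = comult g * tmap id dif (comult h)"
    and coactR: "g \<in> homog 0 \<Longrightarrow> h \<in> homog 0 \<Longrightarrow> coactR (g * dif h) = comult g * tmap dif id (comult h)"

text \<open>
  The universal differential envelope.  A pair \<open>(h, [\<gamma>\<^sub>1, \<dots>, \<gamma>\<^sub>k])\<close> stands for the element
  \<open>h \<gamma>\<^sub>1 \<otimes> \<dots> \<otimes> \<gamma>\<^sub>k\<close> of the \<open>k\<close>-fold tensor power of \<open>\<Gamma>\<close> over \<open>H\<close> (which is \<open>H\<close> for \<open>k = 0\<close>), so
  the direct sum of these powers is the free vector space on such pairs modulo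
  \<open>tensor_power_relators\<close>.  The span of \<open>envelope_relators\<close> is, modulo these, the two-sided ideal
  generated by the elements \<open>\<Sum>\<^sub>i dg\<^sub>i \<otimes> dh\<^sub>i\<close> with \<open>\<Sum>\<^sub>i g\<^sub>i dh\<^sub>i = 0\<close>; the factor \<open>c\<close> accounts for right
  multiplication by \<open>H\<close>.
\<close>

definition words :: "('w::graded_diff_star_algebra \<times> 'w list) set"
  where "words = {(h, gs). h \<in> homog 0 \<and> set gs \<subseteq> homog 1}"

definition eval_word :: "'w::graded_diff_star_algebra \<times> 'w list \<Rightarrow> 'w"
  where "eval_word = (\<lambda>(h, gs). h * prod_list gs)"

definition tensor_power_relators ::
    "('w::graded_diff_star_algebra \<times> 'w list \<Rightarrow>\<^sub>0 complex) set"
  where "tensor_power_relators =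
     {basis (h + h', gs) - (basis (h, gs) + basis (h', gs)) | h h' gs.
        h \<in> homog 0 \<and> h' \<in> homog 0 \<and> set gs \<subseteq> homog 1}
   \<union> {basis (c *\<^sub>C h, gs) - c *\<^sub>C basis (h, gs) | c h gs. h \<in> homog 0 \<and> set gs \<subseteq> homog 1}
   \<union> {basis (h, gs @ (x + y) # ds) - (basis (h, gs @ x # ds) + basis (h, gs @ y # ds)) | h gs x y ds.
        h \<in> homog 0 \<and> set gs \<union> {x, y} \<union> set ds \<subseteq> homog 1}
   \<union> {basis (h, gs @ (c *\<^sub>C x) # ds) - c *\<^sub>C basis (h, gs @ x # ds) | c h gs x ds.
        h \<in> homog 0 \<and> set gs \<union> {x} \<union> set ds \<subseteq> homog 1}
   \<union> {basis (h * a, x # ds) - basis (h, (a * x) # ds) | h a x ds.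
        h \<in> homog 0 \<and> a \<in> homog 0 \<and> {x} \<union> set ds \<subseteq> homog 1}
   \<union> {basis (h, gs @ (x * a) # y # ds) - basis (h, gs @ x # (a * y) # ds) | h gs x a y ds.
        h \<in> homog 0 \<and> a \<in> homog 0 \<and> set gs \<union> {x, y} \<union> set ds \<subseteq> homog 1}"

definition envelope_relators ::
    "('w::graded_diff_star_algebra \<times> 'w list \<Rightarrow>\<^sub>0 complex) set"
  where "envelope_relators =
     {\<Sum>(a, b)\<leftarrow>ps. basis (h, gs @ dif a # (dif b * c) # ds) | ps h gs c ds.
        h \<in> homog 0 \<and> c \<in> homog 0 \<and> set gs \<union> set ds \<subseteq> homog 1 \<and>
        set ps \<subseteq> homog 0 \<times> homog 0 \<and> (\<Sum>(a, b)\<leftarrow>ps. a * dif b) = 0}"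

definition left_invariant_forms ::
    "('w::graded_diff_star_algebra \<Rightarrow> ('w, 'w) tensor) \<Rightarrow> 'w set"
  where "left_invariant_forms coactL = {\<theta> \<in> homog 1. coactL \<theta> = 1 \<otimes> \<theta>}"

definition germs_map ::
    "('w::graded_diff_star_algebra \<Rightarrow> ('w, 'w) tensor) \<Rightarrow> ('w \<Rightarrow> 'w) \<Rightarrow> 'w \<Rightarrow> 'w"
  where "germs_map comult antipode g = tmult (tmap antipode dif (comult g))"

definition corepresentation ::
    "('w::graded_diff_star_algebra \<Rightarrow> ('w, 'w) tensor) \<Rightarrow> ('w \<Rightarrow> complex) \<Rightarrow>
      'v::complex_vector set \<Rightarrow> ('v \<Rightarrow> ('v, 'w) tensor) \<Rightarrow> bool"
  where "corepresentation comult counit V \<delta> \<longleftrightarrow>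
     csubspace V \<and> clinear \<delta> \<and> \<delta> ` V \<subseteq> tensor_of V (homog 0) \<and>
     (\<forall>v\<in>V. tlift (\<lambda>x h. counit h *\<^sub>C x) (\<delta> v) = v) \<and>
     (\<forall>v\<in>V. tmap id comult (\<delta> v) = tassoc (tmap \<delta> id (\<delta> v)))"

definition tensor_corepresentation ::
    "('v::complex_vector \<Rightarrow> ('v, 'w::complex_algebra) tensor) \<Rightarrow>
     ('u::complex_vector \<Rightarrow> ('u, 'w) tensor) \<Rightarrow> ('v, 'u) tensor \<Rightarrow> (('v, 'u) tensor, 'w) tensor"
  where "tensor_corepresentation \<alpha> \<beta> =
     tlift (\<lambda>v u. tlift (\<lambda>v0 v1. tlift (\<lambda>u0 u1. (v0 \<otimes> u0) \<otimes> (v1 * u1)) (\<beta> u)) (\<alpha> v))"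

locale quantum_group_calculus = bicovariant_star_calculus comult counit antipode coactL coactR
  for comult :: "'w::graded_diff_star_algebra \<Rightarrow> ('w, 'w) tensor"
    and counit antipode coactL coactR +
  fixes ad :: "'w \<Rightarrow> ('w, 'w) tensor"
  assumes envelope_surj: "linext eval_word ` {f. Poly_Mapping.keys f \<subseteq> words} = (UNIV :: 'w set)"
    and envelope_kernel: "Poly_Mapping.keys f \<subseteq> (words :: ('w \<times> 'w list) set) \<Longrightarrow>
      linext eval_word f = 0 \<longleftrightarrow> f \<in> cspan (tensor_power_relators \<union> envelope_relators)"
    and ad_corepresentation: "corepresentation comult counit (left_invariant_forms coactL) ad"
    \<comment> \<open>\<open>ad (\<pi> g) = \<pi> g\<^sub>2 \<otimes> S g\<^sub>1 g\<^sub>3\<close>\<close>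
    and ad_germs: "g \<in> homog 0 \<Longrightarrow> ad (germs_map comult antipode g) =
      tlift (\<lambda>t z. tlift (\<lambda>x y. germs_map comult antipode y \<otimes> (antipode x * z)) t)
        (tmap comult id (comult g))"
    and comult_left_invariant: "\<theta> \<in> left_invariant_forms coactL \<Longrightarrow> comult \<theta> = 1 \<otimes> \<theta> + ad \<theta>"

section \<open>Quantum principal bundles with differential calculus\<close>

definition quantum_principal_bundle ::
    "('w::graded_diff_star_algebra \<Rightarrow> ('w, 'w) tensor) \<Rightarrow> ('w \<Rightarrow> complex) \<Rightarrow>
      'o::graded_diff_star_algebra set \<Rightarrow> 'o set \<Rightarrow> ('o \<Rightarrow> ('o, 'w) tensor) \<Rightarrow> bool"
  where "quantum_principal_bundle comult counit P B \<delta> \<longleftrightarrow>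
     star_subalgebra P \<and> star_subalgebra B \<and> B \<subseteq> P \<and>
     corepresentation comult counit P \<delta> \<and>
     \<delta> 1 = 1 \<and> (\<forall>x\<in>P. \<forall>y\<in>P. \<delta> (x * y) = \<delta> x * \<delta> y) \<and> (\<forall>x\<in>P. \<delta> (star x) = star (\<delta> x)) \<and>
     (\<forall>x\<in>P. \<delta> x = x \<otimes> 1 \<longleftrightarrow> x \<in> B) \<and>
     tlift (\<lambda>x y. (x \<otimes> 1) * \<delta> y) ` tensor_of P P = tensor_of P (homog 0)"

text \<open>Existence of a C*-norm, so that the completion is a C*-algebra.\<close>

definition cstar_completable :: "'o::graded_diff_star_algebra set \<Rightarrow> bool"
  where "cstar_completable B \<longleftrightarrow> (\<exists>\<nu> :: 'o \<Rightarrow> real.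
     (\<forall>x\<in>B. 0 \<le> \<nu> x \<and> (\<nu> x = 0 \<longleftrightarrow> x = 0)) \<and>
     (\<forall>x\<in>B. \<forall>y\<in>B. \<nu> (x + y) \<le> \<nu> x + \<nu> y \<and> \<nu> (x * y) \<le> \<nu> x * \<nu> y) \<and>
     (\<forall>c. \<forall>x\<in>B. \<nu> (c *\<^sub>C x) = cmod c * \<nu> x) \<and>
     (\<forall>x\<in>B. \<nu> (star x * x) = (\<nu> x)\<^sup>2))"

text \<open>The type \<open>'o\<close> carries the algebra of forms on the total space; its degree-zero part is \<open>P\<close>.
  The bundle coaction is the restriction of \<open>coact\<close> to \<open>P\<close>.\<close>

locale bundle_calculus = quantum_group_calculus comult counit antipode coactL coactR ad
  for comult :: "'w::graded_diff_star_algebra \<Rightarrow> ('w, 'w) tensor"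
    and counit antipode coactL coactR ad +
  fixes B :: "'o::graded_diff_star_algebra set"
    and coact :: "'o \<Rightarrow> ('o, 'w) tensor"
  assumes principal_bundle: "quantum_principal_bundle comult counit (homog 0) B coact"
    and base_completable: "cstar_completable B"
    and coact_hom: "graded_diff_star_algebra_hom coact"
    and forms_generated_by_P: "generated_diff_star_algebra (homog 0 :: 'o set) = UNIV"

definition base_forms ::
    "('o::graded_diff_star_algebra \<Rightarrow> ('o, 'w::graded_diff_star_algebra) tensor) \<Rightarrow> 'o set"
  where "base_forms coact = {\<mu>. coact \<mu> = \<mu> \<otimes> 1}"

definition quantum_principal_connection ::
    "'w::graded_diff_star_algebra set \<Rightarrow> ('w \<Rightarrow> ('w, 'w) tensor) \<Rightarrow>
      ('o::graded_diff_star_algebra \<Rightarrow> ('o, 'w) tensor) \<Rightarrow> ('w \<Rightarrow> 'o) \<Rightarrow> bool"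
  where "quantum_principal_connection qg ad coact \<omega> \<longleftrightarrow>
     clinear \<omega> \<and> (\<forall>\<theta>\<in>qg. \<omega> \<theta> \<in> homog 1 \<and> coact (\<omega> \<theta>) = tmap \<omega> id (ad \<theta>) + 1 \<otimes> \<theta>)"

text \<open>For \<open>t = \<Sum> \<theta>\<^sub>i \<otimes> \<theta>'\<^sub>j\<close>, the element \<open>tflip (star t)\<close> is \<open>\<Sum> \<theta>'\<^sub>j\<^sup>* \<otimes> \<theta>\<^sub>i\<^sup>*\<close>.\<close>

definition embedded_differential ::
    "'w::graded_diff_star_algebra set \<Rightarrow> ('w \<Rightarrow> ('w, 'w) tensor) \<Rightarrow> ('w \<Rightarrow> ('w, 'w) tensor) \<Rightarrow> bool"
  where "embedded_differential qg ad \<Theta> \<longleftrightarrow>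
     clinear \<Theta> \<and> \<Theta> ` qg \<subseteq> tensor_of qg qg \<and>
     (\<forall>\<theta>\<in>qg. tensor_corepresentation ad ad (\<Theta> \<theta>) = tmap \<Theta> id (ad \<theta>)) \<and>
     (\<forall>\<theta>\<in>qg. dif \<theta> = tmult (\<Theta> \<theta>)) \<and>
     (\<forall>\<theta>\<in>qg. \<Theta> (star \<theta>) = - tflip (star (\<Theta> \<theta>)))"

definition curvature ::
    "('w::graded_diff_star_algebra \<Rightarrow> ('w, 'w) tensor) \<Rightarrow> ('w \<Rightarrow> 'o::graded_diff_star_algebra) \<Rightarrow> 'w \<Rightarrow> 'o"
  where "curvature \<Theta> \<omega> \<theta> = dif (\<omega> \<theta>) - tmult (tmap \<omega> \<omega> (\<Theta> \<theta>))"

section \<open>The quantum gauge group and the associated maps\<close>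

definition quantum_gauge_group ::
    "('o::graded_diff_star_algebra \<Rightarrow> ('o, 'w::graded_diff_star_algebra) tensor) \<Rightarrow> ('o \<Rightarrow> 'o) set"
  where "quantum_gauge_group coact = {F. bij F \<and> clinear F \<and> (\<forall>n. F ` homog n \<subseteq> homog n) \<and>
     (\<forall>\<mu>\<in>base_forms coact. \<forall>w. F (\<mu> * w) = \<mu> * F w) \<and> F 1 = 1 \<and>
     (\<forall>w. tmap F id (coact w) = coact (F w))}"

text \<open>The tensor square over a subalgebra \<open>A\<close>, as the quotient of the tensor square over the complex
  numbers by \<open>balancing_subspace A\<close>; its elements are cosets.\<close>

definition balancing_subspace :: "'o::complex_algebra set \<Rightarrow> ('o, 'o) tensor set"
  where "balancing_subspace A = cspan {(x * a) \<otimes> y - x \<otimes> (a * y) | x a y. a \<in> A}"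

definition balanced_class ::
    "'o::complex_algebra set \<Rightarrow> ('o, 'o) tensor \<Rightarrow> ('o, 'o) tensor set"
  where "balanced_class A t = {t'. t' - t \<in> balancing_subspace A}"

definition balanced_square :: "'o::complex_algebra set \<Rightarrow> ('o, 'o) tensor set set"
  where "balanced_square A = range (balanced_class A)"

text \<open>The following three maps are constant on cosets (for \<open>F\<close> left \<open>A\<close>-linear in the case of
  \<open>balanced_map\<close>), so \<open>the_elem\<close> extracts the value of the induced map.\<close>

definition balanced_mult :: "('o::complex_algebra, 'o) tensor set \<Rightarrow> 'o"
  where "balanced_mult X = the_elem (tmult ` X)"

definition balanced_map ::
    "'o::complex_algebra set \<Rightarrow> ('o \<Rightarrow> 'o) \<Rightarrow> ('o, 'o) tensor set \<Rightarrow> ('o, 'o) tensor set"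
  where "balanced_map A F X = the_elem ((\<lambda>t. balanced_class A (tmap id F t)) ` X)"

definition beta_tilde ::
    "('o::graded_diff_star_algebra \<Rightarrow> ('o, 'w::graded_diff_star_algebra) tensor) \<Rightarrow>
      ('o, 'o) tensor set \<Rightarrow> ('o, 'w) tensor"
  where "beta_tilde coact X = the_elem (tlift (\<lambda>x y. (x \<otimes> 1) * coact y) ` X)"

definition qtrs ::
    "('o::graded_diff_star_algebra \<Rightarrow> ('o, 'w::graded_diff_star_algebra) tensor) \<Rightarrow>
      'w \<Rightarrow> ('o, 'o) tensor set"
  where "qtrs coact \<theta> =
     inv_into (balanced_square (base_forms coact)) (beta_tilde coact) (1 \<otimes> \<theta>)"

definition gauge_map ::
    "('o::graded_diff_star_algebra \<Rightarrow> ('o, 'w::graded_diff_star_algebra) tensor) \<Rightarrow>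
      ('o \<Rightarrow> 'o) \<Rightarrow> 'w \<Rightarrow> 'o"
  where "gauge_map coact F = balanced_mult \<circ> balanced_map (base_forms coact) F \<circ> qtrs coact"

end

theory Submission
  imports Defs
begin

text \<open>
  Two ideas.  First, \<open>\<beta>\<close> is left \<open>\<Omega>(P)\<close>-linear, so \<open>m \<circ> (id \<otimes> F)\<close> factors through it as
  \<open>x \<otimes> \<theta> \<mapsto> x * f \<theta>\<close>; evaluating at \<open>1 \<otimes> w\<close> gives \<open>F = m \<circ> (id \<otimes> f) \<circ> \<Delta>\<close>, from which both formulas follow
  once the coaction on \<open>\<omega> \<theta>\<close> and on \<open>R \<theta>\<close> is known.  Second, the failure of \<open>R\<close> to be covariant is
  \<open>(\<omega> \<otimes> id)\<close> applied to an element of \<open>qg \<otimes> \<Gamma>\<close> that does not depend on the bundle or on the connection.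
  On the quantum group itself the identity is a connection, with curvature \<open>0\<close> because
  \<open>d = m \<circ> \<Theta>\<close> on left-invariant forms, so that element vanishes.
\<close>

section \<open>Linear maps on tensor products\<close>

lemma clinear_uminus: "clinear f \<Longrightarrow> clinear (\<lambda>x. - f x)"
  by (simp add: clinear_iff)

lemma clinear_zero: "clinear (\<lambda>_. 0)"
  by (simp add: clinear_iff)

lemma clinear_minus: "clinear f \<Longrightarrow> clinear g \<Longrightarrow> clinear (\<lambda>x. f x - g x)"
  by (simp add: clinear_iff cvec.scale_right_diff_distrib)

lemma cbilinear_tensor_maps: "clinear f \<Longrightarrow> clinear g \<Longrightarrow> cbilinear (\<lambda>x y. f x \<otimes> g y)"
  by (intro cbilinearI clinear_tensor_left clinear_tensor_right)

lemma clinear_tmap: "clinear f \<Longrightarrow> clinear g \<Longrightarrow> clinear (tmap f g)"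
  unfolding tmap_def by (intro clinear_tlift cbilinear_tensor_maps)

lemma tmap_pure: "clinear f \<Longrightarrow> clinear g \<Longrightarrow> tmap f g (x \<otimes> y) = f x \<otimes> g y"
  unfolding tmap_def by (intro tlift_pure cbilinear_tensor_maps)

lemma tmap_tmap:
  assumes "clinear f" "clinear g" "clinear f'" "clinear g'"
  shows "tmap f g (tmap f' g' t) = tmap (\<lambda>x. f (f' x)) (\<lambda>y. g (g' y)) t"
proof (rule tensor_linear_eqI[of "\<lambda>t. tmap f g (tmap f' g' t)"])
  have comp: "clinear (\<lambda>x. f (f' x))" "clinear (\<lambda>y. g (g' y))"
    by (rule clinear_compose; fact assms)+
  show "clinear (\<lambda>t. tmap f g (tmap f' g' t))"
    by (rule clinear_compose; intro clinear_tmap assms)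
  show "clinear (tmap (\<lambda>x. f (f' x)) (\<lambda>y. g (g' y)))"
    by (intro clinear_tmap comp)
  show "tmap f g (tmap f' g' (x \<otimes> y)) = tmap (\<lambda>x. f (f' x)) (\<lambda>y. g (g' y)) (x \<otimes> y)" for x y
    by (simp add: tmap_pure assms comp)
qed

lemma clinear_id: "clinear id"
  by (simp add: clinear_iff)

lemma tmap_id_id: "tmap id id t = t"
  by (rule tensor_linear_eqI[of "tmap id id" "\<lambda>t. t"])
    (simp_all add: clinear_tmap clinear_id clinear_ident tmap_pure)

lemma cbilinear_mult: "cbilinear ((*) :: 'a::complex_algebra \<Rightarrow> _)"
  by (intro cbilinearI clinear_left_mult clinear_right_mult clinear_ident)

lemma clinear_tmult: "clinear tmult"
  unfolding tmult_def by (intro clinear_tlift cbilinear_mult)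

lemma tmult_pure: "tmult (x \<otimes> y) = x * y"
  unfolding tmult_def by (rule tlift_pure[OF cbilinear_mult])

text \<open>Both directions rest on the linearity of \<open>tlift\<close> in its function argument:
  it makes the inner lift bilinear in \<open>a\<close> and \<open>b\<close>, and it carries
  linearity in \<open>t\<close> through the outer lift.\<close>

lemma cbilinear_tlift2:
  assumes "\<And>a b. cbilinear (\<phi> a b)" "\<And>c d. cbilinear (\<lambda>a b. \<phi> a b c d)"
  shows "cbilinear (\<lambda>s t. tlift (\<lambda>a b. tlift (\<phi> a b) t) s)"
proof -
  have fun_eq: "\<phi> (a + a') b = (\<lambda>c d. \<phi> a b c d + \<phi> a' b c d)"
    "\<phi> a (b + b') = (\<lambda>c d. \<phi> a b c d + \<phi> a b' c d)"
    "\<phi> (k *\<^sub>C a) b = (\<lambda>c d. k *\<^sub>C \<phi> a b c d)"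
    "\<phi> a (k *\<^sub>C b) = (\<lambda>c d. k *\<^sub>C \<phi> a b c d)" for a a' b b' k
    using assms(2) by (auto simp: fun_eq_iff cbilinear_def clinear_iff)
  have "cbilinear (\<lambda>a b. tlift (\<phi> a b) t)" for t
    by (intro cbilinearI clinearI) (simp_all only: fun_eq tlift_plus_fun tlift_scale_fun)
  moreover have "clinear (\<lambda>t. tlift (\<lambda>a b. tlift (\<phi> a b) t) s)" for s
    by (rule clinearI)
      (simp_all add: clinear_add[OF clinear_tlift[OF assms(1)]] clinear_scale[OF clinear_tlift[OF assms(1)]]
        tlift_plus_fun tlift_scale_fun)
  ultimately show ?thesis by (intro cbilinearI) (blast intro: clinear_tlift)+
qed

lemma tlift2_pure:
  assumes "\<And>a b. cbilinear (\<phi> a b)" "\<And>c d. cbilinear (\<lambda>a b. \<phi> a b c d)"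
  shows "tlift (\<lambda>a b. tlift (\<phi> a b) (u \<otimes> v)) (x \<otimes> y) = \<phi> x y u v"
  using assms by simp

lemma cbilinear_compose: "cbilinear \<phi> \<Longrightarrow> clinear f \<Longrightarrow> clinear g \<Longrightarrow> cbilinear (\<lambda>x y. \<phi> (f x) (g y))"
  by (simp add: cbilinear_def clinear_iff)

text \<open>The degree and covariance conditions on a connection hold on left-invariant forms only,
  so linear maps have to be compared on pure tensors with factors in prescribed subsets.\<close>

lemma tensor_of_induct:
  assumes "t \<in> tensor_of V W" "clinear f" "clinear g"
    and "\<And>x y. x \<in> V \<Longrightarrow> y \<in> W \<Longrightarrow> f (x \<otimes> y) = g (x \<otimes> y)"
  shows "f t = g t"
  using clinear_span_induct[OF assms(1)[unfolded tensor_of_def] assms(2,3)] assms(4) by blast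

section \<open>The product of two corepresentations\<close>

text \<open>The inner part of \<open>tensor_corepresentation\<close>, separated from the coactions
  \<open>\<alpha>\<close> and \<open>\<beta>\<close> so that it is a bilinear operation on tensors
  that have already been coacted on.\<close>

definition tensor_corep_mult ::
    "('v::complex_vector, 'w::complex_algebra) tensor \<Rightarrow> ('u::complex_vector, 'w) tensor \<Rightarrow>
      (('v, 'u) tensor, 'w) tensor"
  where "tensor_corep_mult s t =
    tlift (\<lambda>v0 v1. tlift (\<lambda>u0 u1. (v0 \<otimes> u0) \<otimes> (v1 * u1)) t) s"

lemma
  fixes v0 :: "'v::complex_vector" and u0 :: "'u::complex_vector" and v1 u1 :: "'w::complex_algebra"
  shows tensor_corep_mult_pure: "tensor_corep_mult (v0 \<otimes> v1) (u0 \<otimes> u1) = (v0 \<otimes> u0) \<otimes> (v1 * u1)"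
    and cbilinear_tensor_corep_mult: "cbilinear (tensor_corep_mult ::
      ('v, 'w) tensor \<Rightarrow> ('u, 'w) tensor \<Rightarrow> (('v, 'u) tensor, 'w) tensor)"
proof -
  have 1: "cbilinear (\<lambda>(u0::'u) (u1::'w). (v0 \<otimes> u0) \<otimes> (v1 * u1))" for v0 :: 'v and v1
    by (intro cbilinear_tensor_maps clinear_tensor_right clinear_left_mult clinear_ident)
  have 2: "cbilinear (\<lambda>(v0::'v) (v1::'w). (v0 \<otimes> u0) \<otimes> (v1 * u1))" for u0 :: 'u and u1
    by (intro cbilinear_tensor_maps clinear_tensor_left clinear_right_mult clinear_ident)
  show "tensor_corep_mult (v0 \<otimes> v1) (u0 \<otimes> u1) = (v0 \<otimes> u0) \<otimes> (v1 * u1)"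
    unfolding tensor_corep_mult_def by (rule tlift2_pure[OF 1 2])
  have eq: "(tensor_corep_mult :: ('v, 'w) tensor \<Rightarrow> ('u, 'w) tensor \<Rightarrow> _) =
      (\<lambda>s t. tlift (\<lambda>v0 v1. tlift (\<lambda>u0 u1. (v0 \<otimes> u0) \<otimes> (v1 * u1)) t) s)"
    by (intro ext) (rule tensor_corep_mult_def)
  show "cbilinear (tensor_corep_mult ::
      ('v, 'w) tensor \<Rightarrow> ('u, 'w) tensor \<Rightarrow> (('v, 'u) tensor, 'w) tensor)"
    unfolding eq by (rule cbilinear_tlift2[OF 1 2])
qed

lemma
  assumes "clinear \<alpha>" "clinear \<beta>"
  shows clinear_tensor_corepresentation: "clinear (tensor_corepresentation \<alpha> \<beta>)"
    and tensor_corepresentation_pure: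
      "tensor_corepresentation \<alpha> \<beta> (v \<otimes> u) = tensor_corep_mult (\<alpha> v) (\<beta> u)"
proof -
  have eq: "tensor_corepresentation \<alpha> \<beta> = tlift (\<lambda>v u. tensor_corep_mult (\<alpha> v) (\<beta> u))"
    by (simp add: tensor_corepresentation_def tensor_corep_mult_def)
  have bil: "cbilinear (\<lambda>v u. tensor_corep_mult (\<alpha> v) (\<beta> u))"
    by (rule cbilinear_compose[OF cbilinear_tensor_corep_mult assms])
  show "clinear (tensor_corepresentation \<alpha> \<beta>)"
    unfolding eq by (rule clinear_tlift[OF bil])
  show "tensor_corepresentation \<alpha> \<beta> (v \<otimes> u) = tensor_corep_mult (\<alpha> v) (\<beta> u)"
    unfolding eq by (rule tlift_pure[OF bil])
qed

section \<open>Covariance of the curvature\<close>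

text \<open>The part of bidegree \<open>(1, 1)\<close> of the coaction on a product of two connection forms.\<close>

definition mixed_part ::
    "('w::complex_algebra \<Rightarrow> ('w, 'w) tensor) \<Rightarrow> ('w, 'w) tensor \<Rightarrow> ('w, 'w) tensor"
  where "mixed_part ad =
    tlift (\<lambda>u v. tmap id (\<lambda>h. h * v) (ad u) - tmap id (\<lambda>h. u * h) (ad v))"

text \<open>The variable is the multiplier, which sits inside the function argument of
  \<open>tmap\<close>; linearity comes from that of \<open>tlift\<close> in its function.\<close>

lemma clinear_tmap_mult:
  fixes s :: "('v::complex_vector, 'w::complex_algebra) tensor"
  shows "clinear (\<lambda>v. tmap id (\<lambda>h. h * v) s)" "clinear (\<lambda>v. tmap id (\<lambda>h. v * h) s)"
  unfolding tmap_def
  by (rule clinearI; simp add: distrib_left distrib_right mult_scaleC_left mult_scaleC_right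
      tensor_add_right tensor_scale_right tlift_plus_fun tlift_scale_fun)+

lemma cbilinear_mixed_part:
  fixes ad :: "'a::complex_algebra \<Rightarrow> ('a, 'a) tensor"
  assumes "clinear ad"
  shows "cbilinear (\<lambda>u v. tmap id (\<lambda>h. h * v) (ad u) - tmap id (\<lambda>h. u * h) (ad v))"
proof (rule cbilinearI)
  have l: "clinear (\<lambda>h. u * h)" and r: "clinear (\<lambda>h. h * u)" for u :: 'a
    by (intro clinear_left_mult clinear_right_mult clinear_ident)+
  show "clinear (\<lambda>v. tmap id (\<lambda>h. h * v) (ad u) - tmap id (\<lambda>h. u * h) (ad v))" for u
    by (rule clinear_minus[OF clinear_tmap_mult(1) clinear_compose[OF clinear_tmap[OF clinear_id l] assms]])
  show "clinear (\<lambda>u. tmap id (\<lambda>h. h * v) (ad u) - tmap id (\<lambda>h. u * h) (ad v))" for v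
    by (rule clinear_minus[OF clinear_compose[OF clinear_tmap[OF clinear_id r] assms] clinear_tmap_mult(2)])
qed

lemma clinear_mixed_part: "clinear ad \<Longrightarrow> clinear (mixed_part ad)"
  unfolding mixed_part_def by (rule clinear_tlift[OF cbilinear_mixed_part])

lemma mixed_part_pure:
  "clinear ad \<Longrightarrow> mixed_part ad (u \<otimes> v) = tmap id (\<lambda>h. h * v) (ad u) - tmap id (\<lambda>h. u * h) (ad v)"
  unfolding mixed_part_def by (rule tlift_pure[OF cbilinear_mixed_part])

text \<open>These rules sort the coaction on products and differentials of connection forms by
  bidegree. The factors of \<open>tmap \<omega> id s\<close> have degrees 1 and 0, so the only
  Koszul signs arise when a form \<open>v\<close> of degree 1, or the differential, passes
  \<open>\<omega> x\<close>.\<close>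

lemma coaction_products:
  fixes \<omega> :: "'w::graded_diff_star_algebra \<Rightarrow> 'o::graded_diff_star_algebra"
  assumes \<omega>: "clinear \<omega>" "\<And>\<theta>. \<theta> \<in> V \<Longrightarrow> \<omega> \<theta> \<in> homog 1"
    and s: "s \<in> tensor_of V (homog 0 :: 'w set)"
  shows mult_horizontal: "t \<in> tensor_of V (homog 0) \<Longrightarrow>
      tmap \<omega> id s * tmap \<omega> id t = tmap (\<lambda>r. tmult (tmap \<omega> \<omega> r)) id (tensor_corep_mult s t)"
    and mult_vertical_right: "tmap \<omega> id s * (1 \<otimes> v) = tmap \<omega> id (tmap id (\<lambda>h. h * v) s)"
    and mult_vertical_left: "v \<in> homog 1 \<Longrightarrow>
      (1 \<otimes> v) * tmap \<omega> id s = - tmap \<omega> id (tmap id (\<lambda>h. v * h) s)"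
    and dif_horizontal: "dif (tmap \<omega> id s) = tmap (\<lambda>x. dif (\<omega> x)) id s - tmap \<omega> id (tmap id dif s)"
proof -
  note lin = clinear_tmap[OF \<omega>(1) clinear_id]
  have R: "clinear (\<lambda>r. tmult (tmap \<omega> \<omega> r))"
    by (intro clinear_compose[OF clinear_tmult] clinear_tmap \<omega>)
  have bil1: "clinear (\<lambda>t. tensor_corep_mult s t)" and bil2: "clinear (\<lambda>s. tensor_corep_mult s t)"
    for s t :: "('w, 'w) tensor"
    using cbilinear_tensor_corep_mult unfolding cbilinear_def by auto
  have l: "clinear (\<lambda>s. tmap \<omega> id s * c)" "clinear (\<lambda>s. c * tmap \<omega> id s)" for c :: "('o, 'w) tensor"
    by (rule clinear_right_mult[OF lin], rule clinear_left_mult[OF lin])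
  have pure: "tmap \<omega> id (x \<otimes> h) = \<omega> x \<otimes> h" for x h
    by (simp add: tmap_pure \<omega> clinear_id)
  \<comment> \<open>Both sides are bilinear in \<open>s\<close> and \<open>t\<close>: first
    \<open>t\<close> is reduced to pure tensors with a pure left factor fixed, then
    \<open>s\<close>.\<close>
  have 1: "tmap \<omega> id (x \<otimes> h) * tmap \<omega> id t =
      tmap (\<lambda>r. tmult (tmap \<omega> \<omega> r)) id (tensor_corep_mult (x \<otimes> h) t)"
    if t: "t \<in> tensor_of V (homog 0)" and xh: "x \<in> V" "h \<in> homog 0" for x t and h :: 'w
    by (rule tensor_of_induct[where f = "\<lambda>t. tmap \<omega> id (x \<otimes> h) * tmap \<omega> id t",
          OF t l(2) clinear_compose[OF clinear_tmap[OF R clinear_id] bil1]])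
      (use xh \<omega>(2) in \<open>simp add: pure tensor_mult_homog[where i = 0 and j = 1] tensor_corep_mult_pure
        tmap_pure R clinear_id \<omega>(1) tmult_pure\<close>)
  show "tmap \<omega> id s * tmap \<omega> id t = tmap (\<lambda>r. tmult (tmap \<omega> \<omega> r)) id (tensor_corep_mult s t)"
    if t: "t \<in> tensor_of V (homog 0)"
    by (rule tensor_of_induct[where f = "\<lambda>s. tmap \<omega> id s * tmap \<omega> id t",
          OF s l(1) clinear_compose[OF clinear_tmap[OF R clinear_id] bil2]])
      (rule 1[OF t])
  show "tmap \<omega> id s * (1 \<otimes> v) = tmap \<omega> id (tmap id (\<lambda>h. h * v) s)"
  proof (rule tensor_of_induct[where f = "\<lambda>s. tmap \<omega> id s * (1 \<otimes> v)", OF s l(1)])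
    have m: "clinear (\<lambda>h. h * v)" by (intro clinear_right_mult clinear_ident)
    show "clinear (\<lambda>s. tmap \<omega> id (tmap id (\<lambda>h. h * v) s))"
      by (rule clinear_compose[OF lin clinear_tmap[OF clinear_id m]])
    show "tmap \<omega> id (x \<otimes> h) * (1 \<otimes> v) = tmap \<omega> id (tmap id (\<lambda>h. h * v) (x \<otimes> h))"
      if "h \<in> homog 0" for x h
      using that by (simp add: pure tmap_pure clinear_id m tensor_mult_homog[OF _ homog_one])
  qed
  show "(1 \<otimes> v) * tmap \<omega> id s = - tmap \<omega> id (tmap id (\<lambda>h. v * h) s)" if v: "v \<in> homog 1"
  proof (rule tensor_of_induct[where f = "\<lambda>s. (1 \<otimes> v) * tmap \<omega> id s", OF s l(2)])
    have m: "clinear (\<lambda>h. v * h)" by (intro clinear_left_mult clinear_ident)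
    show "clinear (\<lambda>s. - tmap \<omega> id (tmap id (\<lambda>h. v * h) s))"
      by (rule clinear_uminus[OF clinear_compose[OF lin clinear_tmap[OF clinear_id m]]])
    show "(1 \<otimes> v) * tmap \<omega> id (x \<otimes> h) = - tmap \<omega> id (tmap id (\<lambda>h. v * h) (x \<otimes> h))"
      if "x \<in> V" for x h
      by (simp add: pure tmap_pure clinear_id m tensor_mult_homog[OF v \<omega>(2)[OF that]])
  qed
  show "dif (tmap \<omega> id s) = tmap (\<lambda>x. dif (\<omega> x)) id s - tmap \<omega> id (tmap id dif s)"
  proof (rule tensor_of_induct[where f = "\<lambda>s. dif (tmap \<omega> id s)", OF s])
    have d: "clinear (\<lambda>x. dif (\<omega> x))" by (rule clinear_compose[OF clinear_dif \<omega>(1)])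
    show "clinear (\<lambda>s. dif (tmap \<omega> id s))" by (rule clinear_compose[OF clinear_dif lin])
    show "clinear (\<lambda>s. tmap (\<lambda>x. dif (\<omega> x)) id s - tmap \<omega> id (tmap id dif s))"
      by (rule clinear_minus[OF clinear_tmap[OF d clinear_id]
            clinear_compose[OF lin clinear_tmap[OF clinear_id clinear_dif]]])
    show "dif (tmap \<omega> id (x \<otimes> h)) = tmap (\<lambda>x. dif (\<omega> x)) id (x \<otimes> h) - tmap \<omega> id (tmap id dif (x \<otimes> h))"
      if "x \<in> V" for x h
      by (simp add: pure tmap_pure clinear_id clinear_dif d tensor_dif_homog[OF \<omega>(2)[OF that]])
  qed
qed

lemma clinear_curvature:
  assumes "clinear \<Theta>" "clinear \<omega>"
  shows "clinear (curvature \<Theta> \<omega>)"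
proof -
  have "clinear (\<lambda>\<theta>. dif (\<omega> \<theta>) - tmult (tmap \<omega> \<omega> (\<Theta> \<theta>)))"
    by (intro clinear_minus clinear_compose[OF clinear_dif] clinear_compose[OF clinear_tmult]
        clinear_compose[OF clinear_tmap] assms)
  then show ?thesis by (simp add: curvature_def[abs_def])
qed

text \<open>Stated for any morphism \<open>\<delta>\<close>, so that it serves both the bundle and
  the quantum group itself. In the difference of \<open>\<delta> (dif (\<omega> \<theta>))\<close>
  and the coaction on the quadratic term, the two copies of \<open>1 \<otimes> dif \<theta>\<close>
  cancel because \<open>\<Theta>\<close> represents the differential, the horizontal terms form the
  curvature because \<open>\<Theta>\<close> intertwines, and the terms of bidegree (1, 1)
  remain.\<close>

lemma coaction_curvature_defect:
  fixes \<delta> :: "'o::graded_diff_star_algebra \<Rightarrow> ('o, 'w::graded_diff_star_algebra) tensor"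
  assumes \<delta>: "graded_diff_algebra_hom \<delta>"
    and ad: "clinear ad" "ad ` qg \<subseteq> tensor_of qg (homog 0)"
    and qg: "qg \<subseteq> homog 1"
    and \<omega>: "quantum_principal_connection qg ad \<delta> \<omega>"
    and \<Theta>: "embedded_differential qg ad \<Theta>"
    and \<theta>: "\<theta> \<in> qg"
  shows "\<delta> (curvature \<Theta> \<omega> \<theta>) = tmap (curvature \<Theta> \<omega>) id (ad \<theta>)
    - tmap \<omega> id (tmap id dif (ad \<theta>) + mixed_part ad (\<Theta> \<theta>))"
proof -
  have \<delta>lin: "clinear \<delta>" and \<delta>mult: "\<And>x y. \<delta> (x * y) = \<delta> x * \<delta> y"
    and \<delta>dif: "\<And>x. \<delta> (dif x) = dif (\<delta> x)"
    using \<delta> by (auto simp: graded_diff_algebra_hom_def)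
  have \<omega>lin: "clinear \<omega>" and \<omega>deg: "\<And>\<theta>. \<theta> \<in> qg \<Longrightarrow> \<omega> \<theta> \<in> homog 1"
    and \<omega>co: "\<And>\<theta>. \<theta> \<in> qg \<Longrightarrow> \<delta> (\<omega> \<theta>) = tmap \<omega> id (ad \<theta>) + 1 \<otimes> \<theta>"
    using \<omega> by (auto simp: quantum_principal_connection_def)
  have \<Theta>lin: "clinear \<Theta>" and \<Theta>in: "\<Theta> \<theta> \<in> tensor_of qg qg"
    and \<Theta>ad: "tensor_corepresentation ad ad (\<Theta> \<theta>) = tmap \<Theta> id (ad \<theta>)"
    and \<Theta>d: "dif \<theta> = tmult (\<Theta> \<theta>)"
    using \<Theta> \<theta> by (auto simp: embedded_differential_def)
  have ad_in: "ad u \<in> tensor_of qg (homog 0)" if "u \<in> qg" for u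
    using ad(2) that by blast
  define M where "M = (\<lambda>r. tmult (tmap \<omega> \<omega> r))"
  have Mlin: "clinear M"
    unfolding M_def by (intro clinear_compose[OF clinear_tmult] clinear_tmap \<omega>lin)
  note lin = clinear_tmap[OF \<omega>lin clinear_id]
  \<comment> \<open>Expanding the product of two coacted connection forms gives the tensor
    corepresentation in bidegree (2, 0), two cross terms making up \<open>mixed_part\<close> in (1,
    1), and the product in the envelope in (0, 2).\<close>
  have product: "\<delta> (M t) = tmap M id (tensor_corepresentation ad ad t) + tmap \<omega> id (mixed_part ad t)
      + 1 \<otimes> tmult t" if t: "t \<in> tensor_of qg qg" for t
  proof (rule tensor_of_induct[OF t, of "\<lambda>t. \<delta> (M t)"])
    show "clinear (\<lambda>t. \<delta> (M t))" by (rule clinear_compose[OF \<delta>lin Mlin])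
    show "clinear (\<lambda>t. tmap M id (tensor_corepresentation ad ad t) + tmap \<omega> id (mixed_part ad t)
        + 1 \<otimes> tmult t)"
      by (intro clinear_plus clinear_tensor_right clinear_tmult clinear_compose[OF lin]
          clinear_mixed_part ad(1) clinear_compose[OF clinear_tmap] Mlin clinear_id
          clinear_tensor_corepresentation)
    fix u v assume uv: "u \<in> qg" "v \<in> qg"
    have "\<delta> (M (u \<otimes> v)) = (tmap \<omega> id (ad u) + 1 \<otimes> u) * (tmap \<omega> id (ad v) + 1 \<otimes> v)"
      by (simp add: M_def tmap_pure \<omega>lin tmult_pure \<delta>mult \<omega>co uv)
    also have "\<dots> = tmap \<omega> id (ad u) * tmap \<omega> id (ad v) + tmap \<omega> id (ad u) * (1 \<otimes> v)
        + (1 \<otimes> u) * tmap \<omega> id (ad v) + (1 \<otimes> u) * (1 \<otimes> v)"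
      by (simp add: algebra_simps)
    also have "(1 \<otimes> u) * (1 \<otimes> v) = (1 :: 'o) \<otimes> (u * v)"
      using qg uv by (subst tensor_mult_homog[where i = 1 and j = 0]) (auto simp: homog_one)
    also have "tmap \<omega> id (ad u) * tmap \<omega> id (ad v) = tmap M id (tensor_corep_mult (ad u) (ad v))"
      unfolding M_def by (rule mult_horizontal[OF \<omega>lin \<omega>deg ad_in ad_in]) (use uv in auto)
    also have "tmap \<omega> id (ad u) * (1 \<otimes> v) = tmap \<omega> id (tmap id (\<lambda>h. h * v) (ad u))"
      by (rule mult_vertical_right[OF \<omega>lin \<omega>deg ad_in]) (use uv in auto)
    also have "(1 \<otimes> u) * tmap \<omega> id (ad v) = - tmap \<omega> id (tmap id (\<lambda>h. u * h) (ad v))"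
      by (rule mult_vertical_left[OF \<omega>lin \<omega>deg ad_in]) (use uv qg in auto)
    finally show "\<delta> (M (u \<otimes> v)) = tmap M id (tensor_corepresentation ad ad (u \<otimes> v))
        + tmap \<omega> id (mixed_part ad (u \<otimes> v)) + 1 \<otimes> tmult (u \<otimes> v)"
      unfolding tensor_corepresentation_pure[OF ad(1) ad(1)] mixed_part_pure[OF ad(1)]
        clinear_diff[OF lin] tmult_pure by (simp only: diff_conv_add_uminus add.assoc)
  qed
  \<comment> \<open>The Leibniz rule for \<open>1 * 1\<close> gives \<open>dif 1 = 0\<close>, so the
    vertical term \<open>1 \<otimes> \<theta>\<close> contributes only
    \<open>1 \<otimes> dif \<theta>\<close>.\<close>
  have "\<delta> (dif (\<omega> \<theta>)) = dif (tmap \<omega> id (ad \<theta>)) + 1 \<otimes> dif \<theta>"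
    using tensor_dif_homog[OF homog_one, where y = \<theta> and 'a = 'o]
      dif_mult[OF homog_one, of "1 :: 'o"]
    by (simp add: \<delta>dif \<omega>co[OF \<theta>] dif_add clinear_0[OF clinear_tensor_left[OF clinear_ident]])
  also have "dif (tmap \<omega> id (ad \<theta>)) = tmap (\<lambda>x. dif (\<omega> x)) id (ad \<theta>) - tmap \<omega> id (tmap id dif (ad \<theta>))"
    by (rule dif_horizontal[OF \<omega>lin \<omega>deg ad_in[OF \<theta>]])
  finally have 1: "\<delta> (dif (\<omega> \<theta>)) =
      tmap (\<lambda>x. dif (\<omega> x)) id (ad \<theta>) - tmap \<omega> id (tmap id dif (ad \<theta>)) + 1 \<otimes> dif \<theta>" .
  \<comment> \<open>The intertwining property of \<open>\<Theta>\<close> turns the horizontal part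
    into the quadratic term of the curvature, applied to the first factor of
    \<open>ad \<theta>\<close>.\<close>
  have "tmap M id (tensor_corepresentation ad ad (\<Theta> \<theta>)) = tmap (\<lambda>x. M (\<Theta> x)) id (ad \<theta>)"
    unfolding \<Theta>ad by (simp add: tmap_tmap Mlin clinear_id \<Theta>lin id_def[symmetric])
  then have 2: "\<delta> (M (\<Theta> \<theta>)) =
      tmap (\<lambda>x. M (\<Theta> x)) id (ad \<theta>) + tmap \<omega> id (mixed_part ad (\<Theta> \<theta>)) + 1 \<otimes> dif \<theta>"
    using product[OF \<Theta>in] by (simp add: \<Theta>d)
  have "tmap (curvature \<Theta> \<omega>) id t = tmap (\<lambda>x. dif (\<omega> x)) id t - tmap (\<lambda>x. M (\<Theta> x)) id t"
    for t :: "('w, 'w) tensor"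
  proof (rule tensor_linear_eqI[of "tmap (curvature \<Theta> \<omega>) id"])
    have l: "clinear (\<lambda>x. dif (\<omega> x))" "clinear (\<lambda>x. M (\<Theta> x))"
      by (intro clinear_compose[OF clinear_dif] clinear_compose[OF Mlin] \<omega>lin \<Theta>lin)+
    show "clinear (tmap (curvature \<Theta> \<omega>) id)"
      by (intro clinear_tmap clinear_curvature \<omega>lin \<Theta>lin clinear_id)
    show "clinear (\<lambda>t. tmap (\<lambda>x. dif (\<omega> x)) id t - tmap (\<lambda>x. M (\<Theta> x)) id t)"
      by (intro clinear_minus clinear_tmap clinear_id l)
    show "tmap (curvature \<Theta> \<omega>) id (x \<otimes> y) =
        tmap (\<lambda>x. dif (\<omega> x)) id (x \<otimes> y) - tmap (\<lambda>x. M (\<Theta> x)) id (x \<otimes> y)" for x y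
      by (simp add: tmap_pure l clinear_id clinear_curvature \<omega>lin \<Theta>lin)
        (simp add: curvature_def M_def clinear_diff[OF clinear_tensor_left[OF clinear_ident]])
  qed
  moreover have "\<delta> (curvature \<Theta> \<omega> \<theta>) = \<delta> (dif (\<omega> \<theta>)) - \<delta> (M (\<Theta> \<theta>))"
    by (simp add: curvature_def M_def clinear_diff[OF \<delta>lin])
  ultimately show ?thesis
    unfolding 1 2 by (simp add: clinear_add[OF lin])
qed

lemma coaction_curvature:
  fixes coact :: "'o::graded_diff_star_algebra \<Rightarrow> ('o, 'w::graded_diff_star_algebra) tensor"
  assumes calculus: "bundle_calculus comult counit antipode coactL coactR ad B coact"
    and qg: "qg = left_invariant_forms coactL"
    and \<omega>: "quantum_principal_connection qg ad coact \<omega>"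
    and \<Theta>: "embedded_differential qg ad \<Theta>"
    and \<theta>: "\<theta> \<in> qg"
  shows "coact (curvature \<Theta> \<omega> \<theta>) = tmap (curvature \<Theta> \<omega>) id (ad \<theta>)"
proof -
  interpret bundle_calculus comult counit antipode coactL coactR ad B coact
    by (rule calculus)
  have ad: "clinear ad" "ad ` qg \<subseteq> tensor_of qg (homog 0)"
    using ad_corepresentation by (simp_all add: corepresentation_def qg)
  have qg1: "qg \<subseteq> homog 1"
    by (auto simp: qg left_invariant_forms_def)
  have comult: "graded_diff_algebra_hom comult" and coact: "graded_diff_algebra_hom coact"
    using comult_hom coact_hom by (simp_all add: graded_diff_star_algebra_hom_def)
  \<comment> \<open>Here \<open>comult\<close> is the coaction of the quantum group on its own
    envelope, and the connection condition for \<open>id\<close> is the formula for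
    \<open>comult\<close> on left-invariant forms.\<close>
  have "quantum_principal_connection qg ad comult id"
    using qg1 comult_left_invariant
    by (auto simp: quantum_principal_connection_def clinear_id tmap_id_id qg add.commute)
  note defect = coaction_curvature_defect[OF comult ad qg1 this \<Theta> \<theta>]
  \<comment> \<open>The Maurer-Cartan equation: the identity connection is flat.\<close>
  have MC: "curvature \<Theta> id \<theta>' = 0" if "\<theta>' \<in> qg" for \<theta>'
    using \<Theta> that by (simp add: curvature_def tmap_id_id embedded_differential_def)
  have \<Theta>lin: "clinear \<Theta>" using \<Theta> by (simp add: embedded_differential_def)
  \<comment> \<open>Flatness is available on \<open>qg\<close> only, which suffices because
    \<open>ad \<theta>\<close> has its first factors there.\<close>
  have "tmap (curvature \<Theta> id) id (ad \<theta>) = 0"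
  proof (rule tensor_of_induct[where f = "tmap (curvature \<Theta> id) id" and g = "\<lambda>_. 0"])
    show "ad \<theta> \<in> tensor_of qg (homog 0)" using ad \<theta> by blast
  qed (simp_all add: clinear_tmap clinear_curvature \<Theta>lin clinear_id tmap_pure MC
      clinear_0[OF clinear_tensor_left[OF clinear_ident]] clinear_zero)
  moreover have "comult 0 = 0"
    using comult by (auto simp: graded_diff_algebra_hom_def intro: clinear_0)
  \<comment> \<open>For the connection \<open>id\<close> the map \<open>tmap id id\<close> is the
    identity, so the formula yields the vanishing of the defect element itself and not just of its
    image under a connection.\<close>
  ultimately have "tmap id dif (ad \<theta>) + mixed_part ad (\<Theta> \<theta>) = 0"
    using defect unfolding MC[OF \<theta>] tmap_id_id by (metis diff_0 neg_equal_0_iff_equal)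
  moreover have "tmap \<omega> id 0 = 0"
    using \<omega> by (intro clinear_0 clinear_tmap clinear_id) (simp add: quantum_principal_connection_def)
  ultimately show ?thesis
    using coaction_curvature_defect[OF coact ad qg1 \<omega> \<Theta> \<theta>] by simp
qed

section \<open>Recovering a gauge transformation from its associated map\<close>

lemma balanced_class_self: "t \<in> balanced_class A t"
  by (simp add: balanced_class_def balancing_subspace_def cvec.span_zero)

lemma balanced_class_eq_iff:
  "balanced_class A s = balanced_class A t \<longleftrightarrow> s - t \<in> balancing_subspace A"
proof
  assume "s - t \<in> balancing_subspace A"
  then have "r - s \<in> balancing_subspace A \<longleftrightarrow> r - t \<in> balancing_subspace A" for r
    unfolding balancing_subspace_def
    using cvec.span_add[of "r - s" _ "s - t"] cvec.span_diff[of "r - t" _ "s - t"] by auto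
  then show "balanced_class A s = balanced_class A t" by (simp add: balanced_class_def)
qed (use balanced_class_self[of s A] in \<open>auto simp: balanced_class_def\<close>)

lemma the_elem_image_const:
  assumes "x \<in> X" "\<And>y. y \<in> X \<Longrightarrow> f y = f x"
  shows "the_elem (f ` X) = f x"
proof -
  have "f ` X = {f x}" using assms by blast
  then show ?thesis by simp
qed

text \<open>A balanced linear map kills the generators of \<open>balancing_subspace A\<close>, so it
  is constant on cosets and any representative gives the value of the induced map.\<close>

lemma the_elem_image_balanced_class:
  assumes "clinear f" "\<And>x a y. a \<in> A \<Longrightarrow> f ((x * a) \<otimes> y) = f (x \<otimes> (a * y))"
  shows "the_elem (f ` balanced_class A t) = f t"
proof (rule the_elem_image_const[OF balanced_class_self])
  fix t' assume "t' \<in> balanced_class A t"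
  then have "t' - t \<in> cspan {(x * a) \<otimes> y - x \<otimes> (a * y) | x a y. a \<in> A}"
    by (simp add: balanced_class_def balancing_subspace_def)
  then have "f (t' - t) = 0"
    by (rule clinear_span_induct[OF _ assms(1), where g = "\<lambda>_. 0"])
      (auto simp: assms clinear_diff[OF assms(1)] clinear_zero)
  then show "f t' = f t" by (simp add: clinear_diff[OF assms(1)])
qed

lemma balanced_mult_class: "balanced_mult (balanced_class A t) = tmult t"
  unfolding balanced_mult_def
  by (rule the_elem_image_balanced_class) (simp_all add: clinear_tmult tmult_pure mult.assoc)

text \<open>The values are cosets rather than vectors, so the previous criterion does not apply
  directly. Left \<open>A\<close>-linearity of \<open>F\<close> makes \<open>tmap id F\<close> send
  each generator of \<open>balancing_subspace A\<close> to another one.\<close>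

lemma balanced_map_class:
  fixes F :: "'a::complex_algebra \<Rightarrow> 'a"
  assumes "clinear F" "\<And>\<mu> w. \<mu> \<in> A \<Longrightarrow> F (\<mu> * w) = \<mu> * F w"
  shows "balanced_map A F (balanced_class A t) = balanced_class A (tmap id F t)"
  unfolding balanced_map_def
proof (rule the_elem_image_const[OF balanced_class_self])
  define L :: "('a, 'a) tensor \<Rightarrow> ('a, 'a) tensor" where "L = tmap id F"
  have lin: "clinear L" unfolding L_def by (rule clinear_tmap[OF clinear_id assms(1)])
  have L_pure: "L (x \<otimes> y) = x \<otimes> F y" for x y by (simp add: L_def tmap_pure clinear_id assms(1))
  fix t' assume "t' \<in> balanced_class A t"
  then have "t' - t \<in> cspan {(x * a) \<otimes> y - x \<otimes> (a * y) | x a y. a \<in> A}"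
    by (simp add: balanced_class_def balancing_subspace_def)
  then have "L (t' - t) \<in> balancing_subspace A"
  proof (induction rule: cvec.span_induct_alt)
    case base
    show ?case by (simp add: clinear_0[OF lin] balancing_subspace_def cvec.span_zero)
  next
    case (step c s r)
    then obtain x a y where s: "s = (x * a) \<otimes> y - x \<otimes> (a * y)" and a: "a \<in> A" by blast
    have "L s = (x * a) \<otimes> F y - x \<otimes> (a * F y)"
      by (simp add: s clinear_diff[OF lin] L_pure assms(2)[OF a])
    then have "L s \<in> balancing_subspace A"
      unfolding balancing_subspace_def using a by (intro cvec.span_base) blast
    then show ?case using step
      by (simp add: clinear_add[OF lin] clinear_scale[OF lin] balancing_subspace_def
          cvec.span_add cvec.span_scale)
  qed
  then show "balanced_class A (tmap id F t') = balanced_class A (tmap id F t)"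
    by (simp add: balanced_class_eq_iff clinear_diff[OF lin] flip: L_def)
qed

text \<open>Linearity is part of the claim because \<open>qtrs\<close> is defined by a choice of
  inverse image; it is recovered from the linearity of the maps on representatives.\<close>

lemma gauge_transformation_as_convolution:
  fixes coact :: "'o::graded_diff_star_algebra \<Rightarrow> ('o, 'w::graded_diff_star_algebra) tensor"
  assumes coact: "graded_diff_algebra_hom coact"
    and bij: "bij_betw (beta_tilde coact) (balanced_square (base_forms coact)) UNIV"
    and F: "F \<in> quantum_gauge_group coact"
  shows "clinear (gauge_map coact F)"
    and "F w = tmult (tmap id (gauge_map coact F) (coact w))"
proof -
  let ?A = "base_forms coact" and ?f = "gauge_map coact F"
  \<comment> \<open>\<open>\<beta>\<close> and \<open>G\<close> are the maps
    \<open>beta_tilde\<close> and the product after \<open>F\<close> on the second factor, lifted to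
    the tensor square over the complex numbers; this replaces cosets by representatives.\<close>
  define \<beta> where "\<beta> = tlift (\<lambda>x y. (x \<otimes> 1) * coact y)"
  define G where "G t = tmult (tmap id F t)" for t
  have co: "clinear coact" "\<And>x y. coact (x * y) = coact x * coact y"
    using coact by (auto simp: graded_diff_algebra_hom_def)
  have Flin: "clinear F" and FA: "\<And>\<mu> w. \<mu> \<in> ?A \<Longrightarrow> F (\<mu> * w) = \<mu> * F w"
    using F by (auto simp: quantum_gauge_group_def)
  have Glin: "clinear G"
    unfolding G_def by (intro clinear_compose[OF clinear_tmult] clinear_tmap clinear_id Flin)
  have G_pure: "G (x \<otimes> y) = x * F y" for x y
    by (simp add: G_def tmap_pure clinear_id Flin tmult_pure)
  have bil: "cbilinear (\<lambda>x y. (x \<otimes> 1) * coact y)"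
    by (intro cbilinearI clinear_left_mult clinear_right_mult clinear_tensor_left clinear_ident co(1))
  have \<beta>lin: "clinear \<beta>"
    unfolding \<beta>_def by (rule clinear_tlift[OF bil])
  have \<beta>_pure: "\<beta> (x \<otimes> y) = (x \<otimes> 1) * coact y" for x y
    unfolding \<beta>_def by (rule tlift_pure[OF bil])
  have mult_one: "(x \<otimes> 1) * (y \<otimes> \<theta>) = (x * y) \<otimes> \<theta>" for x y :: 'o and \<theta> :: 'w
  proof (rule clinear_span_induct[OF homog_span[of y], of "\<lambda>y. (x \<otimes> 1) * (y \<otimes> \<theta>)"])
    show "clinear (\<lambda>y. (x \<otimes> 1) * (y \<otimes> \<theta>))" "clinear (\<lambda>y. (x * y) \<otimes> \<theta>)"
      by (intro clinear_left_mult clinear_tensor_left clinear_ident)+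
  qed (auto simp: tensor_mult_homog[OF homog_one])
  have \<beta>_class: "beta_tilde coact (balanced_class ?A t) = \<beta> t" for t
    unfolding beta_tilde_def \<beta>_def[symmetric]
  proof (rule the_elem_image_balanced_class[OF \<beta>lin])
    fix x a y assume "a \<in> ?A"
    then have "coact a = a \<otimes> 1" by (simp add: base_forms_def)
    then show "\<beta> ((x * a) \<otimes> y) = \<beta> (x \<otimes> (a * y))"
      by (simp add: \<beta>_pure co(2) mult_one flip: mult.assoc)
  qed
  have G_class: "balanced_mult (balanced_map ?A F (balanced_class ?A t)) = G t" for t
    by (simp add: balanced_map_class[OF Flin FA] balanced_mult_class G_def)
  \<comment> \<open>Injectivity of \<open>beta_tilde\<close> puts \<open>s\<close> and
    \<open>t\<close> in the same coset, where \<open>G\<close> is constant; thus \<open>G\<close>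
    factors through \<open>\<beta>\<close>.\<close>
  have \<beta>_inj: "G s = G t" if "\<beta> s = \<beta> t" for s t
  proof -
    have "balanced_class ?A s = balanced_class ?A t"
      using bij that by (intro inj_onD[OF bij_betw_imp_inj_on[OF bij]])
        (simp_all add: \<beta>_class balanced_square_def)
    then show ?thesis by (metis G_class)
  qed
  have f_eq: "?f \<theta> = G t" if "\<beta> t = 1 \<otimes> \<theta>" for \<theta> t
  proof -
    have "1 \<otimes> \<theta> \<in> beta_tilde coact ` balanced_square ?A"
      using bij by (simp add: bij_betw_def)
    note X = f_inv_into_f[OF this] inv_into_into[OF this]
    then obtain s where s: "qtrs coact \<theta> = balanced_class ?A s"
      by (auto simp: qtrs_def balanced_square_def)
    with X(1) have "\<beta> s = 1 \<otimes> \<theta>"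
      by (simp add: qtrs_def \<beta>_class)
    then show ?thesis
      using \<beta>_inj[of s t] that by (simp add: gauge_map_def s G_class)
  qed
  have "\<exists>t. \<beta> t = 1 \<otimes> \<theta>" for \<theta>
  proof -
    have "1 \<otimes> \<theta> \<in> beta_tilde coact ` balanced_square ?A"
      using bij by (simp add: bij_betw_def)
    then show ?thesis by (force simp: balanced_square_def \<beta>_class)
  qed
  \<comment> \<open>The choice \<open>\<tau>\<close> need not be linear: \<open>f_eq\<close> accepts
    every preimage of \<open>1 \<otimes> \<theta>\<close>, in particular sums and multiples of
    chosen ones.\<close>
  then obtain \<tau> where \<tau>: "\<And>\<theta>. \<beta> (\<tau> \<theta>) = 1 \<otimes> \<theta>" by metis
  show f_lin: "clinear ?f"
  proof (rule clinearI)
    fix \<theta> \<theta>' :: 'w and c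
    have "?f (\<theta> + \<theta>') = G (\<tau> \<theta> + \<tau> \<theta>')"
      by (rule f_eq) (simp add: clinear_add[OF \<beta>lin] \<tau> tensor_add_right)
    then show "?f (\<theta> + \<theta>') = ?f \<theta> + ?f \<theta>'"
      by (simp add: clinear_add[OF Glin] f_eq[OF \<tau>])
    have "?f (c *\<^sub>C \<theta>) = G (c *\<^sub>C \<tau> \<theta>)"
      by (rule f_eq) (simp add: clinear_scale[OF \<beta>lin] \<tau> tensor_scale_right)
    then show "?f (c *\<^sub>C \<theta>) = c *\<^sub>C ?f \<theta>"
      by (simp add: clinear_scale[OF Glin] f_eq[OF \<tau>])
  qed
  \<comment> \<open>Left multiplication on the first factor; both \<open>\<beta>\<close> and
    \<open>G\<close> commute with it, which extends the values at
    \<open>1 \<otimes> \<theta>\<close> to \<open>x \<otimes> \<theta>\<close>.\<close>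
  define act where "act x = tmap ((*) x) (id :: 'o \<Rightarrow> 'o)" for x :: 'o
  have act_lin: "clinear (act x)" and act_pure: "act x (y \<otimes> z) = (x * y) \<otimes> z" for x y z
    unfolding act_def by (simp_all add: clinear_tmap clinear_left_mult clinear_ident clinear_id tmap_pure)
  have \<beta>_act: "\<beta> (act x t) = (x \<otimes> 1) * \<beta> t" for x t
  proof (rule tensor_linear_eqI[of "\<lambda>t. \<beta> (act x t)"])
    show "clinear (\<lambda>t. \<beta> (act x t))" by (rule clinear_compose[OF \<beta>lin act_lin])
    show "clinear (\<lambda>t. (x \<otimes> 1) * \<beta> t)" by (rule clinear_left_mult[OF \<beta>lin])
    show "\<beta> (act x (y \<otimes> z)) = (x \<otimes> 1) * \<beta> (y \<otimes> z)" for y z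
      by (simp add: act_pure \<beta>_pure mult_one flip: mult.assoc)
  qed
  have G_act: "G (act x t) = x * G t" for x t
  proof (rule tensor_linear_eqI[of "\<lambda>t. G (act x t)"])
    show "clinear (\<lambda>t. G (act x t))" by (rule clinear_compose[OF Glin act_lin])
    show "clinear (\<lambda>t. x * G t)" by (rule clinear_left_mult[OF Glin])
  qed (simp add: act_pure G_pure mult.assoc)
  define E where "E s = tmult (tmap id ?f s)" for s
  have E_lin: "clinear E"
    unfolding E_def by (intro clinear_compose[OF clinear_tmult] clinear_tmap clinear_id f_lin)
  have E_pure: "E (x \<otimes> \<theta>) = x * ?f \<theta>" for x \<theta>
    by (simp add: E_def tmap_pure clinear_id f_lin tmult_pure)
  \<comment> \<open>This is the factorization of \<open>G\<close> as \<open>E\<close> after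
    \<open>\<beta>\<close>: over a pure tensor \<open>x \<otimes> \<theta>\<close> the preimage is
    \<open>act x (\<tau> \<theta>)\<close>.\<close>
  have "\<exists>t. \<beta> t = s \<and> G t = E s" for s
    using tensor_in_span[of s]
  proof (induction rule: cvec.span_induct_alt)
    case base
    show ?case
      by (intro exI[of _ 0]) (simp add: clinear_0[OF \<beta>lin] clinear_0[OF Glin] clinear_0[OF E_lin])
  next
    case (step c u s)
    then obtain x \<theta> t where u: "u = x \<otimes> \<theta>" and t: "\<beta> t = s" "G t = E s" by blast
    show ?case
      by (intro exI[of _ "c *\<^sub>C act x (\<tau> \<theta>) + t"])
        (simp add: u t clinear_add[OF \<beta>lin] clinear_scale[OF \<beta>lin] clinear_add[OF Glin]
          clinear_scale[OF Glin] clinear_add[OF E_lin] clinear_scale[OF E_lin] E_pure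
          \<beta>_act G_act \<tau> mult_one f_eq[OF \<tau>])
  qed
  then obtain t where t: "\<beta> t = coact w" "G t = E (coact w)" by blast
  \<comment> \<open>A second preimage of \<open>coact w\<close>, on which \<open>G\<close> takes the
    value \<open>F w\<close>.\<close>
  have "\<beta> (1 \<otimes> w) = coact w"
    by (simp add: \<beta>_pure flip: one_tensor_def)
  then have "G (1 \<otimes> w) = G t"
    by (intro \<beta>_inj) (simp add: t)
  then show "F w = tmult (tmap id ?f (coact w))"
    by (simp add: G_pure t E_def)
qed

text \<open>Compatibility with \<open>dif\<close> moves \<open>F\<close> through the linear term of
  the curvature, and multiplicativity moves it through the quadratic one.\<close>

lemma hom_curvature:
  assumes "graded_diff_algebra_hom F" "clinear \<omega>"
  shows "F (curvature \<Theta> \<omega> \<theta>) = curvature \<Theta> (F \<circ> \<omega>) \<theta>"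
proof -
  have F: "clinear F" "\<And>x y. F (x * y) = F x * F y" "\<And>x. F (dif x) = dif (F x)"
    using assms(1) by (auto simp: graded_diff_algebra_hom_def)
  have F\<omega>: "clinear (\<lambda>x. F (\<omega> x))" by (rule clinear_compose[OF F(1) assms(2)])
  have "F (tmult (tmap \<omega> \<omega> t)) = tmult (tmap (F \<circ> \<omega>) (F \<circ> \<omega>) t)" for t
    unfolding o_def
  proof (rule tensor_linear_eqI[of "\<lambda>t. F (tmult (tmap \<omega> \<omega> t))"])
    show "clinear (\<lambda>t. F (tmult (tmap \<omega> \<omega> t)))"
      by (rule clinear_compose[OF F(1) clinear_compose[OF clinear_tmult clinear_tmap[OF assms(2) assms(2)]]])
    show "clinear (\<lambda>t. tmult (tmap (\<lambda>x. F (\<omega> x)) (\<lambda>x. F (\<omega> x)) t))"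
      by (rule clinear_compose[OF clinear_tmult clinear_tmap[OF F\<omega> F\<omega>]])
  qed (simp add: tmap_pure F\<omega> assms(2) tmult_pure F(2))
  then show ?thesis by (simp add: curvature_def clinear_diff[OF F(1)] F(3))
qed

theorem proposition4p8:
  fixes comult :: "'w::graded_diff_star_algebra \<Rightarrow> ('w, 'w) tensor"
    and coact :: "'o::graded_diff_star_algebra \<Rightarrow> ('o, 'w) tensor"
    and \<omega> :: "'w \<Rightarrow> 'o" and F :: "'o \<Rightarrow> 'o"
  assumes calculus: "bundle_calculus comult counit antipode coactL coactR ad B coact"
    and qg: "qg = left_invariant_forms coactL"
    and beta_bij: "bij_betw (beta_tilde coact) (balanced_square (base_forms coact)) UNIV"
    and gauge: "F \<in> quantum_gauge_group coact"
    and connection: "quantum_principal_connection qg ad coact \<omega>"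
    and embedded: "embedded_differential qg ad \<Theta>"
  shows "(\<forall>\<theta>\<in>qg. (F \<circ> \<omega>) \<theta> =
            tmult (tmap \<omega> (gauge_map coact F) (ad \<theta>)) + gauge_map coact F \<theta>) \<and>
         (\<forall>\<theta>\<in>qg. F (curvature \<Theta> \<omega> \<theta>) =
            tmult (tmap (curvature \<Theta> \<omega>) (gauge_map coact F) (ad \<theta>))) \<and>
         (graded_diff_algebra_hom F \<longrightarrow>
           (\<forall>\<theta>\<in>qg. F (curvature \<Theta> \<omega> \<theta>) = curvature \<Theta> (F \<circ> \<omega>) \<theta>))"
proof -
  let ?f = "gauge_map coact F"
  have coact: "graded_diff_algebra_hom coact"
    using bundle_calculus.coact_hom[OF calculus] by (simp add: graded_diff_star_algebra_hom_def)
  note f_lin = gauge_transformation_as_convolution(1)[OF coact beta_bij gauge]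
    and F_eq = gauge_transformation_as_convolution(2)[OF coact beta_bij gauge]
  have \<omega>: "clinear \<omega>" "\<And>\<theta>. \<theta> \<in> qg \<Longrightarrow> coact (\<omega> \<theta>) = tmap \<omega> id (ad \<theta>) + 1 \<otimes> \<theta>"
    using connection by (auto simp: quantum_principal_connection_def)
  have R: "clinear (curvature \<Theta> \<omega>)"
    using embedded by (intro clinear_curvature \<omega>(1)) (simp add: embedded_differential_def)
  have tmap_f: "tmap id ?f (tmap g id t) = tmap g ?f t" if "clinear g" for g :: "'w \<Rightarrow> 'o" and t
    by (simp add: tmap_tmap clinear_id f_lin that)
  \<comment> \<open>The vertical term \<open>1 \<otimes> \<theta>\<close> of the coaction produces
    the inhomogeneous summand; the curvature below has no such term, being covariant.\<close>
  have "(F \<circ> \<omega>) \<theta> = tmult (tmap \<omega> ?f (ad \<theta>)) + ?f \<theta>" if "\<theta> \<in> qg" for \<theta>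
    by (simp add: F_eq[of "\<omega> \<theta>"] \<omega>(2)[OF that] clinear_add[OF clinear_tmap[OF clinear_id f_lin]]
        clinear_add[OF clinear_tmult] tmap_f \<omega>(1) tmap_pure clinear_id f_lin tmult_pure)
  moreover have "F (curvature \<Theta> \<omega> \<theta>) = tmult (tmap (curvature \<Theta> \<omega>) ?f (ad \<theta>))" if "\<theta> \<in> qg" for \<theta>
    by (simp add: F_eq[of "curvature \<Theta> \<omega> \<theta>"] tmap_f R
        coaction_curvature[OF calculus qg connection embedded that])
  ultimately show ?thesis
    using hom_curvature[OF _ \<omega>(1)] by blast
qed

end
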